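(* For every integer $d\ge1$ and every $0<\beta<2$, $$C_{\mathrm{LY}}(\beta,d)=L_\beta(\log\Phi_\beta)(0)=c_{\beta,d}\int_{\mathbb{R}^d}\frac{\psi_\beta(|h|^2)}{|h|^{d+\beta}}\,dh .$$
   Context: Let $d\ge 1$ be an integer and $\beta\in(0,2)$. $|\cdot|$ is the Euclidean norm on $\mathbb{R}^d$ and $\Gamma$ is the Gamma function. Put $$c_{\beta,d}=\frac{2^\beta\,\Gamma((d+\beta)/2)}{\pi^{d/2}\,|\Gamma(-\beta/2)|}.$$ For sufficiently regular $f$, the fractional Laplacian is $$L_\beta f(x)=(-\Delta)^{\beta/2}f(x)=\frac{c_{\beta,d}}{2}\int_{\mathbb{R}^d}\frac{2f(x)-f(x+h)-f(x-h)}{|h|^{d+\beta}}\,dh,\quad x\in\mathbb{R}^d.$$ Let $G^{(\beta)}(t,x)$, $t>0$, $x\in\mathbb{R}^d$, be the fractional heat kernel associated with $L_\beta$, i.e. the function with Fourier transform $\widehat{G^{(\beta)}(t,\cdot)}(\xi)=e^{-t|\xi|^\beta}$, where $\widehat f(\xi)=\int_{\mathbb{R}^d}f(x)e^{-i\langle x,\xi\rangle}\,dx$; it is positive, smooth, radial in $x$, and has integral $1$ in $x$. Put $\Phi_\beta(x)=G^{(\beta)}(1,x)$. The Weber--Zacher constant is $$C_{\mathrm{LY}}(\beta,d)=\frac{c_{\beta,d}}{2}\sup_{y\in\mathbb{R}^d}\int_{\mathbb{R}^d}\frac{1}{|\sigma|^{d+\beta}}\log\frac{\Phi_\beta(y)^2}{\Phi_\beta(y+\sigma)\Phi_\beta(y-\sigma)}\,d\sigma=\sup_{y\in\mathbb{R}^d}L_\beta(\log\Phi_\beta)(y).$$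 For $r\ge0$ let $F_\beta(r)=\Phi_\beta(\sqrt r\,\mathbf{e})$, where $\mathbf{e}\in\mathbb{R}^d$ is any fixed unit vector (the value does not depend on the choice since $\Phi_\beta$ is radial), and let $\psi_\beta(r)=\log\dfrac{F_\beta(0)}{F_\beta(r)}$. *)

theory Defs
  imports "HOL-Analysis.Analysis"
begin

text \<open>The definitions are for an arbitrary Euclidean space, whose dimension \<open>DIM('a)\<close> plays
  the role of \<open>d\<close>; in particular \<open>DIM(real^'n) = CARD('n)\<close>.\<close>

definition frac_const :: "real \<Rightarrow> nat \<Rightarrow> real" where
  "frac_const \<beta> d =
     2 powr \<beta> * Gamma ((real d + \<beta>) / 2) / (pi powr (real d / 2) * \<bar>Gamma (- \<beta> / 2)\<bar>)"

definition frac_laplacian_integrand ::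
    "real \<Rightarrow> ('a::euclidean_space \<Rightarrow> real) \<Rightarrow> 'a \<Rightarrow> 'a \<Rightarrow> real" where
  "frac_laplacian_integrand \<beta> f x h =
     (2 * f x - f (x + h) - f (x - h)) / norm h powr (real DIM('a) + \<beta>)"

text \<open>The Bochner integral is \<open>0\<close> by convention when the integrand is not integrable, so a claim
  about this value is meaningful only together with integrability of the integrand.\<close>

definition frac_laplacian :: "real \<Rightarrow> ('a::euclidean_space \<Rightarrow> real) \<Rightarrow> 'a \<Rightarrow> real" where
  "frac_laplacian \<beta> f x =
     frac_const \<beta> DIM('a) / 2 * (LINT h|lborel. frac_laplacian_integrand \<beta> f x h)"

definition fourier :: "('a::euclidean_space \<Rightarrow> real) \<Rightarrow> 'a \<Rightarrow> complex" where
  "fourier f \<xi> = (LINT x|lborel. complex_of_real (f x) * exp (- \<i> * complex_of_real (x \<bullet> \<xi>)))"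

text \<open>An integrable function is determined by its Fourier transform only almost everywhere;
  continuity selects the pointwise representative. The value is meaningful for \<open>t > 0\<close>.\<close>

definition frac_heat_kernel :: "real \<Rightarrow> real \<Rightarrow> 'a::euclidean_space \<Rightarrow> real" where
  "frac_heat_kernel \<beta> t =
     (THE g. continuous_on UNIV g \<and> integrable lborel g \<and>
             (\<forall>\<xi>. fourier g \<xi> = complex_of_real (exp (- t * norm \<xi> powr \<beta>))))"

definition Phi :: "real \<Rightarrow> 'a::euclidean_space \<Rightarrow> real" where
  "Phi \<beta> x = frac_heat_kernel \<beta> 1 x"

definition LY_integrand :: "real \<Rightarrow> 'a::euclidean_space \<Rightarrow> 'a \<Rightarrow> real" where
  "LY_integrand \<beta> y \<sigma> =
     1 / norm \<sigma> powr (real DIM('a) + \<beta>) *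
     ln ((Phi \<beta> y)\<^sup>2 / (Phi \<beta> (y + \<sigma>) * Phi \<beta> (y - \<sigma>)))"

text \<open>The supremum is taken in the extended reals, so that finiteness of the constant is part of
  any equation with a real number. The type argument carries the space (hence the dimension).\<close>

definition C_LY :: "real \<Rightarrow> 'a::euclidean_space itself \<Rightarrow> ereal" where
  "C_LY \<beta> _ =
     ereal (frac_const \<beta> DIM('a) / 2) *
     (SUP y::'a. ereal (LINT \<sigma>|lborel. LY_integrand \<beta> y \<sigma>))"

definition F_prof :: "real \<Rightarrow> 'a::euclidean_space \<Rightarrow> real \<Rightarrow> real" where
  "F_prof \<beta> e r = Phi \<beta> (sqrt r *\<^sub>R e)"

definition psi :: "real \<Rightarrow> 'a::euclidean_space \<Rightarrow> real \<Rightarrow> real" where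
  "psi \<beta> e r = ln (F_prof \<beta> e 0 / F_prof \<beta> e r)"

end

theory Submission
  imports Defs "HOL-Probability.Characteristic_Functions" "HOL-Real_Asymp.Real_Asymp"
begin

text \<open>
  Write \<open>\<Phi>(x) = F(\<bar>x\<bar>\<^sup>2)\<close>. The supremum is attained at \<open>y = 0\<close> because the integrand itself is
  largest there, for every \<open>\<sigma>\<close>:
  \<open>\<Phi>(y)\<^sup>2 \<Phi>(\<sigma>)\<^sup>2 \<le> \<Phi>(0)\<^sup>2 \<Phi>(y + \<sigma>) \<Phi>(y - \<sigma>)\<close> (lemma \<open>Phi_square_mult_le\<close>).
  This follows from log-convexity of \<open>F\<close>, used twice. Spreading the pair \<open>\<bar>y\<bar>\<^sup>2, \<bar>\<sigma>\<bar>\<^sup>2\<close> to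
  \<open>0, \<bar>y\<bar>\<^sup>2 + \<bar>\<sigma>\<bar>\<^sup>2\<close> increases the product of the values of \<open>F\<close>, and so does spreading the doubled point
  \<open>\<bar>y\<bar>\<^sup>2 + \<bar>\<sigma>\<bar>\<^sup>2\<close> to the pair \<open>\<bar>y + \<sigma>\<bar>\<^sup>2, \<bar>y - \<sigma>\<bar>\<^sup>2\<close>, whose mean it is by the parallelogram law.

  Log-convexity of \<open>F\<close> is due to \<open>\<Phi>\<close> being a mixture of centred Gaussians (subordination). No
  mixing measure is constructed. Finite sums \<open>\<Sum>w\<^sub>i exp(-s\<^sub>i r)\<close> with nonnegative weights are
  log-convex in \<open>r\<close>; as functions of \<open>\<bar>\<xi>\<bar>\<^sup>2\<close>, damped by a Gaussian, they have Fourier transforms of the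
  same kind (\<open>fourier_exp_mixture\<close>); and log-convexity survives pointwise limits. It remains
  to reach \<open>exp(-r\<^sup>\<alpha>)\<close>, \<open>\<alpha> = \<beta>/2\<close>, as a limit of such sums. The function \<open>1 - (1 - z)\<^sup>\<alpha>\<close> is the generating
  function of a probability distribution on the positive integers (Sibuya's), hence a power series with
  nonnegative coefficients, and with \<open>z = exp(-n\<^sup>-\<^sup>1\<^sup>/\<^sup>\<alpha> r)\<close> its \<open>n\<close>-th power tends to \<open>exp(-r\<^sup>\<alpha>)\<close>: this is the
  convergence of normalised sums of Sibuya variables to the one-sided stable law.

  The heat kernel is defined as the unique continuous integrable function with the given Fourier
  transform, so existence and uniqueness come first. Both rest on Fourier inversion, proved by Gaussian
  regularisation; integrability of the inverse transform follows from its nonnegativity.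

  Integrability of the integrands needs two estimates. Near \<open>\<sigma> = 0\<close> the second difference
  of \<open>\<Phi>\<close> is \<open>O(\<bar>\<sigma>\<bar>\<^sup>2)\<close>, since \<open>\<bar>\<xi>\<bar>\<^sup>2 exp(-\<bar>\<xi>\<bar>\<^sup>\<beta>)\<close> is integrable. At infinity \<open>\<Phi>\<close> has a polynomial
  lower bound (\<open>Phi_polynomial_lower_bound\<close>), so that \<open>log \<Phi>\<close> grows only logarithmically; this bound also
  gives positivity of \<open>\<Phi>\<close>. Here \<open>\<beta> < 2\<close> enters again: the Fourier transform is not smooth enough at \<open>0\<close>
  for \<open>\<Phi>\<close> to decay fast.
\<close>

section \<open>Gaussians and their Fourier transforms\<close>

text \<open>The characteristic function of the standard normal distribution, rescaled by \<open>u \<mapsto> \<surd>(2s) u\<close>.\<close>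

lemma gaussian_fourier_real:
  fixes s a :: real
  assumes "s > 0"
  shows "integrable lborel (\<lambda>u. exp (- s * u\<^sup>2))"
    and "integrable lborel (\<lambda>u. complex_of_real (exp (- s * u\<^sup>2)) * exp (- \<i> * complex_of_real (u * a)))"
    and "(LINT u|lborel. complex_of_real (exp (- s * u\<^sup>2)) * exp (- \<i> * complex_of_real (u * a)))
          = complex_of_real (sqrt (pi / s) * exp (- a\<^sup>2 / (4 * s)))"
proof -
  define c where "c = sqrt (2 * s)"
  have c: "c > 0" "c\<^sup>2 = 2 * s" using assms by (auto simp: c_def)
  have den: "std_normal_density (0 + c * u) = 1 / sqrt (2 * pi) * exp (- s * u\<^sup>2)" for u
    by (simp add: std_normal_density_def power_mult_distrib c)
  have "integrable lborel (\<lambda>u. std_normal_density (0 + c * u))"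
    by (rule lborel_integrable_real_affine) (use c in auto)
  from integrable_mult_right[OF this, of "sqrt (2 * pi)"]
  show int: "integrable lborel (\<lambda>u. exp (- s * u\<^sup>2))"
    unfolding den by simp
  show "integrable lborel (\<lambda>u. complex_of_real (exp (- s * u\<^sup>2)) * exp (- \<i> * complex_of_real (u * a)))"
    by (rule Bochner_Integration.integrable_bound[OF int]) (auto simp: norm_mult)
  define t where "t = - a / c"
  have "complex_of_real (exp (- (t\<^sup>2) / 2)) = char std_normal_distribution t"
    by (simp add: char_std_normal_distribution)
  also have "\<dots> = (LINT x|lborel. std_normal_density x *\<^sub>R iexp (t * x))"
    unfolding char_def by (subst integral_density) (auto simp: normal_density_nonneg)
  also have "\<dots> = c *\<^sub>R (LINT u|lborel. std_normal_density (0 + c * u) *\<^sub>R iexp (t * (0 + c * u)))"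
    using c by (subst lborel_integral_real_affine[where c=c and t=0]) auto
  also have "(\<lambda>u. std_normal_density (0 + c * u) *\<^sub>R iexp (t * (0 + c * u)))
      = (\<lambda>u. (1 / sqrt (2 * pi)) *\<^sub>R (complex_of_real (exp (- s * u\<^sup>2)) * exp (- \<i> * complex_of_real (u * a))))"
    unfolding den using c by (auto simp: t_def scaleR_conv_of_real mult_ac)
  also have "c *\<^sub>R (LINT u|lborel. \<dots> u) = (c / sqrt (2 * pi)) *\<^sub>R
      (LINT u|lborel. complex_of_real (exp (- s * u\<^sup>2)) * exp (- \<i> * complex_of_real (u * a)))"
    by (subst integral_scaleR_right) simp
  finally have *: "complex_of_real (exp (- (t\<^sup>2) / 2)) = (c / sqrt (2 * pi)) *\<^sub>R
      (LINT u|lborel. complex_of_real (exp (- s * u\<^sup>2)) * exp (- \<i> * complex_of_real (u * a)))" .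
  have t2: "- (t\<^sup>2) / 2 = - a\<^sup>2 / (4 * s)"
    using c by (simp add: t_def power_divide)
  have cc: "sqrt (pi / s) = sqrt (2 * pi) / c"
    by (simp add: c_def real_sqrt_divide[symmetric])
  show "(LINT u|lborel. complex_of_real (exp (- s * u\<^sup>2)) * exp (- \<i> * complex_of_real (u * a)))
          = complex_of_real (sqrt (pi / s) * exp (- a\<^sup>2 / (4 * s)))"
    using c unfolding cc of_real_mult t2[symmetric] * by (simp add: scaleR_conv_of_real)
qed

lemma integral_lborel_prod:
  fixes f :: "'a::euclidean_space \<Rightarrow> real \<Rightarrow> 'b::{real_normed_field,banach,second_countable_topology}"
  assumes "\<And>b. b \<in> Basis \<Longrightarrow> integrable lborel (f b)"
  shows "integrable lborel (\<lambda>x. \<Prod>b\<in>Basis. f b (x \<bullet> b))"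
    and "(LINT x|lborel. (\<Prod>b\<in>Basis. f b (x \<bullet> b))) = (\<Prod>b\<in>Basis. LINT u|lborel. f b u)"
proof -
  interpret product_sigma_finite "\<lambda>_::'a. lborel :: real measure" by standard
  have [measurable]: "\<And>b. b \<in> Basis \<Longrightarrow> f b \<in> borel_measurable borel"
    using borel_measurable_integrable[OF assms] by simp
  have "integrable (\<Pi>\<^sub>M b\<in>(Basis::'a set). lborel) (\<lambda>x. \<Prod>b\<in>Basis. f b (x b))"
    by (rule product_integrable_prod) (use assms in auto)
  then show "integrable lborel (\<lambda>x. \<Prod>b\<in>Basis. f b (x \<bullet> b))"
    by (subst lborel_eq, subst integrable_distr_eq)
       (auto cong: prod.cong simp: inner_sum_left inner_Basis if_distrib cong: if_cong)
  show "(LINT x|lborel. (\<Prod>b\<in>Basis. f b (x \<bullet> b))) = (\<Prod>b\<in>Basis. LINT u|lborel. f b u)"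
    by (subst lborel_eq, subst integral_distr)
       (auto cong: prod.cong simp: inner_sum_left inner_Basis if_distrib cong: if_cong
         intro!: product_integral_prod assms)
qed

lemma norm_sq_Basis: "(norm (x::'a::euclidean_space))\<^sup>2 = (\<Sum>b\<in>Basis. (x \<bullet> b)\<^sup>2)"
  unfolding power2_norm_eq_inner euclidean_inner[of x x] by (simp add: power2_eq_square)

text \<open>Both \<open>exp(-s\<bar>x\<bar>\<^sup>2)\<close> and the character \<open>exp(-\<i>\<langle>x, \<xi>\<rangle>)\<close> are products over coordinates, so the
  one-dimensional case suffices.\<close>

lemma gaussian_fourier:
  fixes \<xi> :: "'a::euclidean_space"
  assumes "s > 0"
  shows "integrable lborel (\<lambda>x::'a. exp (- s * (norm x)\<^sup>2))"
    and "fourier (\<lambda>x. exp (- s * (norm x)\<^sup>2)) \<xi>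
          = complex_of_real ((pi / s) powr (DIM('a) / 2) * exp (- (norm \<xi>)\<^sup>2 / (4 * s)))"
proof -
  have 1: "exp (- s * (norm x)\<^sup>2) = (\<Prod>b\<in>Basis. exp (- s * (x \<bullet> b)\<^sup>2))" for x :: 'a
    by (simp add: norm_sq_Basis sum_distrib_left exp_sum sum_negf[symmetric])
  show "integrable lborel (\<lambda>x::'a. exp (- s * (norm x)\<^sup>2))"
    unfolding 1 by (rule integral_lborel_prod) (rule gaussian_fourier_real[OF assms])
  have 2: "complex_of_real (exp (- s * (norm x)\<^sup>2)) * exp (- \<i> * complex_of_real (x \<bullet> \<xi>))
    = (\<Prod>b\<in>Basis. complex_of_real (exp (- s * (x \<bullet> b)\<^sup>2)) * exp (- \<i> * complex_of_real (x \<bullet> b * (\<xi> \<bullet> b))))" for x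
    unfolding 1 euclidean_inner[of x \<xi>] of_real_prod
    by (simp add: prod.distrib exp_sum sum_distrib_left sum_negf[symmetric])
  have "fourier (\<lambda>x. exp (- s * (norm x)\<^sup>2)) \<xi>
     = (\<Prod>b\<in>(Basis::'a set). complex_of_real (sqrt (pi / s) * exp (- (\<xi> \<bullet> b)\<^sup>2 / (4 * s))))"
    unfolding fourier_def 2
    by (subst integral_lborel_prod(2)) (simp_all only: gaussian_fourier_real[OF assms])
  also have "\<dots> = complex_of_real (sqrt (pi / s) ^ DIM('a) * exp (- (\<Sum>b\<in>Basis. (\<xi> \<bullet> b)\<^sup>2) / (4 * s)))"
    by (simp add: prod.distrib exp_sum[symmetric] sum_divide_distrib sum_negf[symmetric] exp_of_real[symmetric])
  also have "sqrt (pi / s) ^ DIM('a) = (pi / s) powr (DIM('a) / 2)"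
    using assms by (simp add: powr_half_sqrt[symmetric] powr_realpow[symmetric] powr_powr)
  finally show "fourier (\<lambda>x. exp (- s * (norm x)\<^sup>2)) \<xi>
          = complex_of_real ((pi / s) powr (DIM('a) / 2) * exp (- (norm \<xi>)\<^sup>2 / (4 * s)))"
    by (simp add: norm_sq_Basis)
qed

section \<open>Exponential mixtures and radial log-convexity\<close>

lemma integrable_fourier_integrand:
  fixes f :: "'a::euclidean_space \<Rightarrow> real"
  assumes "integrable lborel f"
  shows "integrable lborel (\<lambda>x. complex_of_real (f x) * exp (- \<i> * complex_of_real (x \<bullet> \<xi>)))"
proof (rule Bochner_Integration.integrable_bound[OF assms])
  show "(\<lambda>x. complex_of_real (f x) * exp (- \<i> * complex_of_real (x \<bullet> \<xi>))) \<in> borel_measurable lborel"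
    using borel_measurable_integrable[OF assms] by measurable
qed (auto simp: norm_mult)

lemma fourier_add:
  assumes "integrable lborel f" "integrable lborel g"
  shows "fourier (\<lambda>x. f x + g x) \<xi> = fourier f \<xi> + fourier g \<xi>"
  unfolding fourier_def
  using assms[THEN integrable_fourier_integrand, of \<xi>]
  by (simp add: distrib_right)

lemma fourier_cmult: "fourier (\<lambda>x. c * f x) \<xi> = complex_of_real c * fourier f \<xi>"
  unfolding fourier_def by (simp add: mult.assoc)

text \<open>The Laplace transforms of the finitely supported measures on \<open>[0, \<infinity>)\<close>. The inductive form is
  convenient because every property needed below is linear or bilinear in the function, so that it has to be
  checked for single exponentials only.\<close>

inductive exp_mixture :: "(real \<Rightarrow> real) \<Rightarrow> bool" where
  zero: "exp_mixture (\<lambda>_. 0)"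
| add: "w \<ge> 0 \<Longrightarrow> s \<ge> 0 \<Longrightarrow> exp_mixture g \<Longrightarrow> exp_mixture (\<lambda>x. w * exp (- s * x) + g x)"

lemma exp_mixture_exp: "w \<ge> 0 \<Longrightarrow> s \<ge> 0 \<Longrightarrow> exp_mixture (\<lambda>x. w * exp (- s * x))"
  using exp_mixture.add[OF _ _ exp_mixture.zero, of w s] by simp

lemma exp_mixture_add:
  assumes "exp_mixture f" "exp_mixture g"
  shows "exp_mixture (\<lambda>x. f x + g x)"
  using assms
proof (induction rule: exp_mixture.induct)
  case (add w s f)
  then show ?case
    using exp_mixture.add[of w s "\<lambda>x. f x + g x"] by (simp add: add.assoc)
qed simp

lemma exp_mixture_mult:
  assumes "exp_mixture f" "exp_mixture g"
  shows "exp_mixture (\<lambda>x. f x * g x)"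
  using assms
proof (induction rule: exp_mixture.induct)
  case zero
  show ?case by (simp add: exp_mixture.zero)
next
  case (add w s f)
  have "exp_mixture (\<lambda>x. w * exp (- s * x) * g x)"
    using add.prems
  proof (induction rule: exp_mixture.induct)
    case zero
    show ?case by (simp add: exp_mixture.zero)
  next
    case (add w' s' g)
    have "(\<lambda>x. w * exp (- s * x) * (w' * exp (- s' * x) + g x))
      = (\<lambda>x. (w * w') * exp (- (s + s') * x) + w * exp (- s * x) * g x)"
    proof
      fix x
      have "exp (- (s + s') * x) = exp (- s * x) * exp (- s' * x)"
        unfolding mult_exp_exp by (simp add: algebra_simps)
      then show "w * exp (- s * x) * (w' * exp (- s' * x) + g x)
        = (w * w') * exp (- (s + s') * x) + w * exp (- s * x) * g x"
        by (simp add: distrib_left)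
    qed
    then show ?case
      using add exp_mixture.add[of "w * w'" "s + s'" "\<lambda>x. w * exp (- s * x) * g x"]
        \<open>w \<ge> 0\<close> \<open>s \<ge> 0\<close> by simp
  qed
  from exp_mixture_add[OF this add.IH[OF add.prems]] show ?case
    by (simp add: distrib_right)
qed

lemma exp_mixture_power: "exp_mixture f \<Longrightarrow> exp_mixture (\<lambda>x. f x ^ n)"
proof (induction n)
  case 0
  show ?case using exp_mixture_exp[of 1 0] by simp
qed (simp add: exp_mixture_mult)

lemma exp_mixture_sum:
  "(\<And>i. i \<in> I \<Longrightarrow> exp_mixture (f i)) \<Longrightarrow> exp_mixture (\<lambda>x. \<Sum>i\<in>I. f i x)"
  by (induction I rule: infinite_finite_induct) (auto intro: exp_mixture.zero exp_mixture_add)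

lemma exp_mixture_nonneg: "exp_mixture f \<Longrightarrow> 0 \<le> f x"
  by (induction rule: exp_mixture.induct) auto

lemma exp_mixture_antimono: "exp_mixture f \<Longrightarrow> x \<le> y \<Longrightarrow> f y \<le> f x"
  by (induction rule: exp_mixture.induct) (auto intro!: add_mono mult_left_mono)

text \<open>After dividing by \<open>exp(-su) exp(-tu)\<close>, the difference of the two sides becomes
  \<open>(exp(-sa) - exp(-ta)) (exp(-sb) - exp(-tb))\<close> with \<open>a = p - u \<ge> 0\<close> and \<open>b = q - u \<ge> 0\<close>, and the two factors have
  the same sign.\<close>

lemma exp_pair_le:
  fixes p q u v s t :: real
  assumes "u \<le> p" "u \<le> q" "p + q = u + v"
  shows "exp (- s * p) * exp (- t * q) + exp (- t * p) * exp (- s * q)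
      \<le> exp (- s * u) * exp (- t * v) + exp (- t * u) * exp (- s * v)"
proof -
  define a b where "a = p - u" and "b = q - u"
  have ab: "a \<ge> 0" "b \<ge> 0" and p: "p = u + a" and q: "q = u + b" and v: "v = u + a + b"
    using assms by (auto simp: a_def b_def)
  have "0 \<le> (exp (- s * a) - exp (- t * a)) * (exp (- s * b) - exp (- t * b))"
  proof (cases "s \<le> t")
    case True
    then show ?thesis using ab by (intro mult_nonneg_nonneg) (simp_all add: mult_right_mono)
  next
    case False
    then show ?thesis using ab by (intro mult_nonpos_nonpos) (simp_all add: mult_right_mono)
  qed
  then have "0 \<le> exp (- s * u) * exp (- t * u) *
      ((exp (- s * a) - exp (- t * a)) * (exp (- s * b) - exp (- t * b)))"
    by simp
  also have "\<dots> = exp (- s * u) * exp (- t * v) + exp (- t * u) * exp (- s * v)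
      - (exp (- s * p) * exp (- t * q) + exp (- t * p) * exp (- s * q))"
  proof -
    have *: "exp (- c * (u + d)) = exp (- c * u) * exp (- c * d)"
      "exp (- c * (u + a + b)) = exp (- c * u) * exp (- c * a) * exp (- c * b)" for c d :: real
      unfolding mult_exp_exp by (simp_all add: algebra_simps)
    define A1 A2 A3 B1 B2 B3 where "A1 = exp (- s * u)" and "A2 = exp (- s * a)" and "A3 = exp (- s * b)"
      and "B1 = exp (- t * u)" and "B2 = exp (- t * a)" and "B3 = exp (- t * b)"
    show ?thesis
      unfolding p q v * A1_def[symmetric] A2_def[symmetric] A3_def[symmetric]
        B1_def[symmetric] B2_def[symmetric] B3_def[symmetric] by (simp add: algebra_simps)
  qed
  finally show ?thesis by simp
qed

text \<open>The polarised form of \<open>f(p) f(q) \<le> f(u) f(v)\<close>; unlike the latter it is bilinear, and so it follows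
  from \<open>exp_pair_le\<close> by two inductions.\<close>

lemma exp_mixture_pair_le:
  assumes "exp_mixture f" "exp_mixture g" "u \<le> p" "u \<le> q" "p + q = u + v"
  shows "f p * g q + g p * f q \<le> f u * g v + g u * f v"
  using assms(1,2)
proof (induction rule: exp_mixture.induct)
  case (add w s f)
  have "exp (- s * p) * g q + g p * exp (- s * q) \<le> exp (- s * u) * g v + g u * exp (- s * v)"
    using add.prems
  proof (induction rule: exp_mixture.induct)
    case (add w t g)
    have "w * (exp (- s * p) * exp (- t * q) + exp (- t * p) * exp (- s * q))
      \<le> w * (exp (- s * u) * exp (- t * v) + exp (- t * u) * exp (- s * v))"
      by (intro mult_left_mono exp_pair_le assms add)
    with add.IH show ?case by (simp add: algebra_simps)
  qed simp
  then have "w * (exp (- s * p) * g q + g p * exp (- s * q)) \<le> w * (exp (- s * u) * g v + g u * exp (- s * v))"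
    using add by (intro mult_left_mono)
  with add.IH[OF add.prems] show ?case by (simp add: algebra_simps)
qed simp

text \<open>For \<open>P(x) = F(\<bar>x\<bar>\<^sup>2)\<close> this says that \<open>F\<close> is nonnegative, decreasing and log-convex, where log-convexity is
  expressed as \<open>F(p) F(q) \<le> F(u) F(v)\<close> whenever \<open>p, q\<close> lie between \<open>u\<close> and \<open>v\<close> and \<open>p + q = u + v\<close>. That \<open>P\<close> is
  radial is contained in the second clause. Each clause is a weak inequality between finitely many values, so the
  property passes to pointwise limits.\<close>

definition radially_log_convex :: "('a::euclidean_space \<Rightarrow> real) \<Rightarrow> bool" where
  "radially_log_convex P \<longleftrightarrow>
     (\<forall>x. 0 \<le> P x) \<and> (\<forall>x y. norm x \<le> norm y \<longrightarrow> P y \<le> P x) \<and>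
     (\<forall>x y u v. norm u \<le> norm x \<longrightarrow> norm u \<le> norm y \<longrightarrow>
        (norm x)\<^sup>2 + (norm y)\<^sup>2 = (norm u)\<^sup>2 + (norm v)\<^sup>2 \<longrightarrow> P x * P y \<le> P u * P v)"

lemma radially_log_convex_nonneg: "radially_log_convex P \<Longrightarrow> 0 \<le> P x"
  by (simp add: radially_log_convex_def)

lemma radially_log_convex_antimono:
  assumes "radially_log_convex P" "norm x \<le> norm y"
  shows "P y \<le> P x"
proof -
  have "\<forall>x y. norm x \<le> norm y \<longrightarrow> P y \<le> P x"
    using assms(1) unfolding radially_log_convex_def by (elim conjE)
  from this[rule_format, OF assms(2)] show ?thesis .
qed

lemma radially_log_convex_spread:
  assumes "radially_log_convex P" "norm u \<le> norm x" "norm u \<le> norm y"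
    "(norm x)\<^sup>2 + (norm y)\<^sup>2 = (norm u)\<^sup>2 + (norm v)\<^sup>2"
  shows "P x * P y \<le> P u * P v"
proof -
  have "\<forall>x y u v. norm u \<le> norm x \<longrightarrow> norm u \<le> norm y \<longrightarrow>
        (norm x)\<^sup>2 + (norm y)\<^sup>2 = (norm u)\<^sup>2 + (norm v)\<^sup>2 \<longrightarrow> P x * P y \<le> P u * P v"
    using assms(1) unfolding radially_log_convex_def by (elim conjE)
  from this[rule_format, OF assms(2-4)] show ?thesis .
qed

lemma radially_log_convex_cmult:
  assumes "radially_log_convex P" "c \<ge> 0"
  shows "radially_log_convex (\<lambda>x. c * P x)"
  unfolding radially_log_convex_def
proof (intro conjI allI impI)
  fix x y u v
  show "0 \<le> c * P x" using assms by (simp add: radially_log_convex_def)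
  show "c * P y \<le> c * P x" if "norm x \<le> norm y"
    using assms that by (simp add: radially_log_convex_def mult_left_mono)
  show "c * P x * (c * P y) \<le> c * P u * (c * P v)"
    if "norm u \<le> norm x" "norm u \<le> norm y" "(norm x)\<^sup>2 + (norm y)\<^sup>2 = (norm u)\<^sup>2 + (norm v)\<^sup>2"
  proof -
    have "P x * P y \<le> P u * P v" using assms(1) that unfolding radially_log_convex_def by blast
    then have "c * c * (P x * P y) \<le> c * c * (P u * P v)" by (intro mult_left_mono) auto
    then show ?thesis by (simp add: mult_ac)
  qed
qed

lemma radially_log_convex_exp_mixture:
  assumes "exp_mixture f"
  shows "radially_log_convex (\<lambda>x::'a::euclidean_space. f ((norm x)\<^sup>2))"
  unfolding radially_log_convex_def
proof (intro conjI allI impI)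
  fix x y u v :: 'a
  show "f ((norm x)\<^sup>2) * f ((norm y)\<^sup>2) \<le> f ((norm u)\<^sup>2) * f ((norm v)\<^sup>2)"
    if "norm u \<le> norm x" "norm u \<le> norm y" "(norm x)\<^sup>2 + (norm y)\<^sup>2 = (norm u)\<^sup>2 + (norm v)\<^sup>2"
    using that exp_mixture_pair_le[OF assms assms, of "(norm u)\<^sup>2" "(norm x)\<^sup>2" "(norm y)\<^sup>2" "(norm v)\<^sup>2"]
    by (simp add: power_mono mult.commute)
  show "0 \<le> f ((norm x)\<^sup>2)"
    by (rule exp_mixture_nonneg[OF assms])
  show "f ((norm y)\<^sup>2) \<le> f ((norm x)\<^sup>2)" if "norm x \<le> norm y"
    using that by (intro exp_mixture_antimono[OF assms] power_mono) auto
qed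

lemma radially_log_convex_limit:
  assumes "\<And>n. radially_log_convex (P n)" "\<And>x. (\<lambda>n. P n x) \<longlonglongrightarrow> Q x"
  shows "radially_log_convex Q"
  unfolding radially_log_convex_def
proof (intro conjI allI impI)
  fix x y u v
  show "0 \<le> Q x"
    using assms(1) by (intro LIMSEQ_le_const[OF assms(2)]) (auto simp: radially_log_convex_def)
  show "Q y \<le> Q x" if "norm x \<le> norm y"
    using assms(1) that by (intro LIMSEQ_le[OF assms(2) assms(2)]) (auto simp: radially_log_convex_def)
  show "Q x * Q y \<le> Q u * Q v"
    if "norm u \<le> norm x" "norm u \<le> norm y" "(norm x)\<^sup>2 + (norm y)\<^sup>2 = (norm u)\<^sup>2 + (norm v)\<^sup>2"
    by (rule LIMSEQ_le[OF tendsto_mult[OF assms(2) assms(2)] tendsto_mult[OF assms(2) assms(2)]])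
       (use assms(1) that in \<open>auto simp: radially_log_convex_def\<close>)
qed

text \<open>A Gaussian of precision \<open>\<delta> + s\<close> is transformed to one of precision \<open>1/(4(\<delta> + s))\<close>. The damping
  \<open>\<delta> > 0\<close> makes the constant term of a mixture integrable.\<close>

lemma fourier_exp_mixture:
  assumes "exp_mixture f" "\<delta> > 0"
  shows "integrable lborel (\<lambda>\<xi>::'a::euclidean_space. exp (- \<delta> * (norm \<xi>)\<^sup>2) * f ((norm \<xi>)\<^sup>2)) \<and>
    (\<exists>h. exp_mixture h \<and> (\<forall>x::'a. fourier (\<lambda>\<xi>. exp (- \<delta> * (norm \<xi>)\<^sup>2) * f ((norm \<xi>)\<^sup>2)) x
       = complex_of_real (h ((norm x)\<^sup>2))))"
  using assms(1)
proof (induction rule: exp_mixture.induct)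
  case zero
  show ?case by (auto simp: fourier_def intro!: exI[of _ "\<lambda>_. 0"] exp_mixture.zero)
next
  case (add w s g)
  define r where "r = \<delta> + s"
  have r: "r > 0" using add assms by (simp add: r_def)
  have eq: "(\<lambda>\<xi>::'a. exp (- \<delta> * (norm \<xi>)\<^sup>2) * (w * exp (- s * (norm \<xi>)\<^sup>2) + g ((norm \<xi>)\<^sup>2)))
    = (\<lambda>\<xi>. w * exp (- r * (norm \<xi>)\<^sup>2) + exp (- \<delta> * (norm \<xi>)\<^sup>2) * g ((norm \<xi>)\<^sup>2))"
  proof
    fix \<xi> :: 'a
    have "exp (- r * (norm \<xi>)\<^sup>2) = exp (- \<delta> * (norm \<xi>)\<^sup>2) * exp (- s * (norm \<xi>)\<^sup>2)"
      unfolding mult_exp_exp r_def by (simp add: algebra_simps)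
    then show "exp (- \<delta> * (norm \<xi>)\<^sup>2) * (w * exp (- s * (norm \<xi>)\<^sup>2) + g ((norm \<xi>)\<^sup>2))
      = w * exp (- r * (norm \<xi>)\<^sup>2) + exp (- \<delta> * (norm \<xi>)\<^sup>2) * g ((norm \<xi>)\<^sup>2)"
      by (simp add: distrib_left)
  qed
  have i1: "integrable lborel (\<lambda>\<xi>::'a. w * exp (- r * (norm \<xi>)\<^sup>2))"
    by (intro integrable_mult_right gaussian_fourier r)
  from add.IH obtain h where i2: "integrable lborel (\<lambda>\<xi>::'a. exp (- \<delta> * (norm \<xi>)\<^sup>2) * g ((norm \<xi>)\<^sup>2))"
    and h: "exp_mixture h" "\<And>x::'a. fourier (\<lambda>\<xi>. exp (- \<delta> * (norm \<xi>)\<^sup>2) * g ((norm \<xi>)\<^sup>2)) x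
       = complex_of_real (h ((norm x)\<^sup>2))" by blast
  have "fourier (\<lambda>\<xi>::'a. exp (- \<delta> * (norm \<xi>)\<^sup>2) * (w * exp (- s * (norm \<xi>)\<^sup>2) + g ((norm \<xi>)\<^sup>2))) x
      = complex_of_real (w * (pi / r) powr (DIM('a) / 2) * exp (- (1 / (4 * r)) * (norm x)\<^sup>2) + h ((norm x)\<^sup>2))" for x
    unfolding eq fourier_add[OF i1 i2] fourier_cmult h gaussian_fourier(2)[OF r] by simp
  then show ?case
    unfolding eq using i1 i2 h(1) r add
    by (intro conjI Bochner_Integration.integrable_add
        exI[of _ "\<lambda>y. w * (pi / r) powr (DIM('a) / 2) * exp (- (1 / (4 * r)) * y) + h y"] exp_mixture.add) auto
qed

section \<open>Integrability of radial functions\<close>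

lemma power_le_fact_exp: "0 \<le> (t::real) \<Longrightarrow> t ^ k \<le> fact k * exp t"
proof -
  assume t: "0 \<le> t"
  have "(\<Sum>n\<in>{k}. t ^ n /\<^sub>R fact n) \<le> (\<Sum>n. t ^ n /\<^sub>R fact n)"
    by (rule sum_le_suminf[OF summable_exp_generic]) (use t in auto)
  then show ?thesis
    by (simp add: exp_def field_simps)
qed

text \<open>On the shell \<open>\<bar>x\<bar> \<approx> \<rho>\<^sup>n\<close> the integrand is of order \<open>\<rho>\<^sup>-\<^sup>n\<^sup>p\<close> and the volume is at most of order
  \<open>\<rho>\<^sup>n\<^sup>d\<close>, which leaves a geometric series of ratio \<open>\<rho>\<^sup>d\<^sup>-\<^sup>p\<close>. With \<open>\<rho> = 2\<close> this covers a neighbourhood of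
  infinity, with \<open>\<rho> = 1/2\<close> one of the origin.\<close>

lemma integrable_norm_powr_shells:
  fixes S :: "'a::euclidean_space set" and \<rho> p :: real
  assumes [measurable]: "S \<in> sets borel" and \<rho>: "\<rho> > 0" and small: "\<rho> powr (real DIM('a) - p) < 1"
    and cover: "S \<subseteq> (\<Union>n. {x. \<rho> ^ n / 2 \<le> norm x \<and> norm x \<le> 2 * \<rho> ^ n})"
  shows "integrable lborel (\<lambda>x. indicator S x * norm x powr (- p))"
proof (rule integrableI_bounded)
  show "(\<lambda>x. indicator S x * norm x powr (- p)) \<in> borel_measurable lborel"
    by measurable
  define V where "V = unit_ball_vol (real DIM('a))"
  have V: "V \<ge> 0" by (simp add: V_def)
  define A :: "nat \<Rightarrow> 'a set" where "A n = {x. \<rho> ^ n / 2 \<le> norm x \<and> norm x \<le> 2 * \<rho> ^ n}" for n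
  have [measurable]: "A n \<in> sets borel" for n by (simp add: A_def)
  define c where "c n = 2 powr \<bar>p\<bar> * (\<rho> powr (- p)) ^ n" for n
  have c: "c n \<ge> 0" for n using \<rho> by (simp add: c_def)
  have bound: "norm x powr (- p) \<le> c n" if "x \<in> A n" for x n
  proof -
    define r where "r = norm x / \<rho> ^ n"
    have r: "1 / 2 \<le> r" "r \<le> 2" using that \<rho> by (auto simp: A_def r_def field_simps)
    have "r powr (- p) \<le> 2 powr \<bar>p\<bar>"
    proof (cases "p \<ge> 0")
      case True
      then have "r powr (- p) \<le> (1 / 2) powr (- p)" using r by (intro powr_mono2') auto
      with True show ?thesis by (simp add: powr_minus powr_divide)
    next
      case False
      then have "r powr (- p) \<le> 2 powr (- p)" using r by (intro powr_mono2) auto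
      with False show ?thesis by simp
    qed
    moreover have "norm x powr (- p) = r powr (- p) * (\<rho> powr (- p)) ^ n"
    proof -
      have "norm x = r * \<rho> ^ n" using \<rho> by (simp add: r_def)
      moreover have "(\<rho> ^ n) powr (- p) = (\<rho> powr (- p)) ^ n"
        using \<rho> by (simp add: powr_realpow[symmetric] powr_powr mult.commute)
      ultimately show ?thesis using \<rho> r by (simp add: powr_mult)
    qed
    ultimately show ?thesis using \<rho> by (simp add: c_def mult_right_mono)
  qed
  have emA: "emeasure lborel (A n) \<le> ennreal (V * (2 * \<rho> ^ n) ^ DIM('a))" for n
  proof -
    have "emeasure lborel (A n) \<le> emeasure lborel (cball (0::'a) (2 * \<rho> ^ n))"
      by (rule emeasure_mono) (auto simp: A_def)
    also have "\<dots> = ennreal (V * (2 * \<rho> ^ n) ^ DIM('a))"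
      unfolding V_def by (rule emeasure_cball) (use \<rho> in simp)
    finally show ?thesis .
  qed
  have le: "ennreal (norm (indicator S x * norm x powr (- p))) \<le> (\<Sum>n. ennreal (c n) * indicator (A n) x)" for x
  proof (cases "x \<in> S")
    case True
    then obtain n where n: "x \<in> A n" using cover by (auto simp: A_def)
    have "ennreal (norm (indicator S x * norm x powr (- p))) \<le> ennreal (c n) * indicator (A n) x"
      using True n bound[OF n] by (simp add: ennreal_leI)
    also have "\<dots> \<le> (\<Sum>n. ennreal (c n) * indicator (A n) x)"
    proof -
      define h where "h m = ennreal (c m) * indicator (A m) x" for m
      have "h n \<le> (\<Sum>m. h m)"
        using sum_le_suminf[of h "{n}"] by simp
      then show ?thesis by (simp only: h_def)
    qed
    finally show ?thesis .
  qed simp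
  define q where "q = \<rho> powr (real DIM('a) - p)"
  have q: "q = \<rho> powr (- p) * \<rho> ^ DIM('a)"
    using \<rho> by (simp add: q_def powr_diff powr_realpow powr_minus field_simps)
  have "(\<integral>\<^sup>+x. ennreal (norm (indicator S x * norm x powr (- p))) \<partial>lborel)
      \<le> (\<integral>\<^sup>+x. (\<Sum>n. ennreal (c n) * indicator (A n) x) \<partial>lborel)"
    by (intro nn_integral_mono le)
  also have "\<dots> = (\<Sum>n. ennreal (c n) * emeasure lborel (A n))"
    by (subst nn_integral_suminf) (auto simp: nn_integral_cmult)
  also have "\<dots> \<le> (\<Sum>n. ennreal (c n) * ennreal (V * (2 * \<rho> ^ n) ^ DIM('a)))"
    by (intro suminf_le mult_left_mono emA) auto
  also have "\<dots> = (\<Sum>n. ennreal (2 powr \<bar>p\<bar> * V * 2 ^ DIM('a) * q ^ n))"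
    by (intro suminf_cong)
       (use \<rho> V c in \<open>simp add: ennreal_mult[symmetric] c_def q power_mult_distrib power_mult[symmetric] mult_ac\<close>)
  also have "\<dots> < \<infinity>"
  proof -
    have "summable (\<lambda>n. 2 powr \<bar>p\<bar> * V * 2 ^ DIM('a) * q ^ n)"
      using small \<rho> by (intro summable_mult summable_geometric) (simp add: q_def)
    moreover have "0 \<le> 2 powr \<bar>p\<bar> * V * 2 ^ DIM('a) * q ^ n" for n
      using V by (simp add: q_def)
    ultimately show ?thesis
      by (simp add: suminf_ennreal2 del: ennreal_mult'')
  qed
  finally show "(\<integral>\<^sup>+x. ennreal (norm (indicator S x * norm x powr (- p))) \<partial>lborel) < \<infinity>" .
qed

lemma integrable_norm_powr_far:
  fixes p :: real
  assumes "p > DIM('a::euclidean_space)"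
  shows "integrable lborel (\<lambda>x::'a. indicator {x. 1 \<le> norm x} x * norm x powr (- p))"
proof (rule integrable_norm_powr_shells[where \<rho> = 2])
  show "2 powr (real DIM('a) - p) < 1"
    using powr_less_mono[of "real DIM('a) - p" 0 2] assms by simp
  show "{x::'a. 1 \<le> norm x} \<subseteq> (\<Union>n. {x. 2 ^ n / 2 \<le> norm x \<and> norm x \<le> 2 * 2 ^ n})"
  proof
    fix x :: 'a assume "x \<in> {x. 1 \<le> norm x}"
    then have x: "1 \<le> norm x" by simp
    define n where "n = (LEAST n. norm x < 2 ^ n)"
    have "\<exists>n. norm x < 2 ^ n" by (rule real_arch_pow) simp
    then have n: "norm x < 2 ^ n" unfolding n_def by (rule LeastI_ex)
    have "n \<noteq> 0" using n x by (metis not_le power_0)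
    then obtain m where m: "n = Suc m" by (cases n) auto
    have "\<not> norm x < 2 ^ m" using not_less_Least[of m "\<lambda>n. norm x < 2 ^ n"] m n_def by simp
    then have "2 ^ n / 2 \<le> norm x" using m by simp
    then show "x \<in> (\<Union>n. {x. 2 ^ n / 2 \<le> norm x \<and> norm x \<le> 2 * 2 ^ n})" using n by force
  qed
qed auto

lemma integrable_norm_powr_near:
  fixes p :: real
  assumes "p < DIM('a::euclidean_space)"
  shows "integrable lborel (\<lambda>x::'a. indicator {x. norm x \<le> 1} x * norm x powr (- p))"
proof -
  have "integrable lborel (\<lambda>x::'a. indicator ({x. norm x \<le> 1} - {0}) x * norm x powr (- p))"
  proof (rule integrable_norm_powr_shells[where \<rho> = "1 / 2"])
    show "(1 / 2) powr (real DIM('a) - p) < 1"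
      using assms by (simp add: powr_divide)
    show "{x::'a. norm x \<le> 1} - {0} \<subseteq> (\<Union>n. {x. (1 / 2) ^ n / 2 \<le> norm x \<and> norm x \<le> 2 * (1 / 2) ^ n})"
    proof
      fix x :: 'a assume "x \<in> {x. norm x \<le> 1} - {0}"
      then have x: "norm x \<le> 1" "norm x > 0" by auto
      define n where "n = (LEAST n. (1 / 2) ^ n < norm x)"
      have "\<exists>n. (1 / 2) ^ n < norm x" by (rule real_arch_pow_inv) (use x in auto)
      then have n: "(1 / 2) ^ n < norm x" unfolding n_def by (rule LeastI_ex)
      have "n \<noteq> 0" using n x by (metis not_le power_0)
      then obtain m where m: "n = Suc m" by (cases n) auto
      have "\<not> (1 / 2) ^ m < norm x" using not_less_Least[of m "\<lambda>n. (1 / 2) ^ n < norm x"] m n_def by simp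
      then have "norm x \<le> 2 * (1 / 2) ^ n" using m by simp
      moreover have "(1 / 2) ^ n / 2 \<le> norm x" using n x by (smt (verit) field_sum_of_halves zero_le_power)
      ultimately show "x \<in> (\<Union>n. {x. (1 / 2) ^ n / 2 \<le> norm x \<and> norm x \<le> 2 * (1 / 2) ^ n})" by blast
    qed
  qed auto
  then show ?thesis
    by (rule Bochner_Integration.integrable_bound) (auto simp: indicator_def)
qed

lemma integrable_norm_powr_mult_exp:
  assumes "\<beta> > 0" "a \<ge> 0"
  shows "integrable lborel (\<lambda>\<xi>::'a::euclidean_space. norm \<xi> powr a * exp (- (norm \<xi> powr \<beta>)))"
proof -
  define p where "p = real DIM('a) + 1"
  \<comment> \<open>\<open>exp(-t) \<le> k! t\<^sup>-\<^sup>k\<close> with \<open>t = r\<^sup>\<beta>\<close> beats the power \<open>r\<^sup>-\<^sup>(\<^sup>a\<^sup>+\<^sup>p\<^sup>)\<close> once \<open>\<beta>k \<ge> a + p\<close>\<close>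
  obtain k :: nat where k: "real k > (a + p) / \<beta>" using reals_Archimedean2 by blast
  then have k: "\<beta> * real k \<ge> a + p" using assms by (simp add: field_simps)
  have "integrable lborel (\<lambda>\<xi>::'a. indicator {x. 1 \<le> norm x} \<xi> * norm \<xi> powr (- p))"
    by (rule integrable_norm_powr_far) (simp add: p_def)
  moreover have "integrable lborel (indicator (cball (0::'a) 1) :: 'a \<Rightarrow> real)"
    by (rule integrable_real_indicator[OF _ emeasure_bounded_finite[OF bounded_cball]]) simp
  ultimately have int: "integrable lborel (\<lambda>\<xi>::'a. indicator (cball 0 1) \<xi> +
      fact k * (indicator {x. 1 \<le> norm x} \<xi> * norm \<xi> powr (- p)))"
    by (intro Bochner_Integration.integrable_add integrable_mult_right)
  show ?thesis
  proof (rule Bochner_Integration.integrable_bound[OF int])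
    show "AE \<xi> in lborel. norm (norm \<xi> powr a * exp (- (norm \<xi> powr \<beta>))) \<le> norm (indicator (cball (0::'a) 1) \<xi> +
      fact k * (indicator {x. 1 \<le> norm x} \<xi> * norm \<xi> powr (- p)))"
    proof (rule AE_I2)
      fix \<xi> :: 'a
      define r where "r = norm \<xi>"
      consider "r \<le> 1" | "r > 1" by linarith
      then show "norm (norm \<xi> powr a * exp (- (norm \<xi> powr \<beta>))) \<le> norm (indicator (cball (0::'a) 1) \<xi> +
        fact k * (indicator {x. 1 \<le> norm x} \<xi> * norm \<xi> powr (- p)))"
      proof cases
        case 1
        then have h: "r powr a * exp (- (r powr \<beta>)) \<le> 1 * 1"
          using assms by (intro mult_mono powr_le1) (auto simp: r_def)
        have J: "0 \<le> fact k * (indicator {x. 1 \<le> norm x} \<xi> * r powr (- p))"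
          by (intro mult_nonneg_nonneg) auto
        have I: "indicator (cball 0 1) \<xi> = (1 :: real)"
          using 1 by (simp add: r_def)
        have "0 \<le> r powr a * exp (- (r powr \<beta>))" by simp
        with h J show ?thesis
          unfolding I real_norm_def r_def[symmetric] by linarith
      next
        case 2
        have "(r powr \<beta>) ^ k \<le> fact k * exp (r powr \<beta>)" by (rule power_le_fact_exp) simp
        moreover have "(r powr \<beta>) ^ k = r powr (\<beta> * k)"
          using 2 by (simp add: powr_realpow[symmetric] powr_powr)
        moreover have "r powr (a + p) \<le> r powr (\<beta> * k)" using 2 k by (intro powr_mono) auto
        ultimately have "r powr (a + p) \<le> fact k * exp (r powr \<beta>)" by linarith
        then have "r powr a * exp (- (r powr \<beta>)) \<le> fact k * r powr (- p)"
          using 2 by (simp add: powr_add powr_minus exp_minus field_simps)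
        with 2 show ?thesis
          by (simp add: r_def[symmetric])
      qed
    qed
  qed measurable
qed

lemma integrable_exp_neg_norm_powr:
  assumes "\<beta> > 0"
  shows "integrable lborel (\<lambda>\<xi>::'a::euclidean_space. exp (- (norm \<xi> powr \<beta>)))"
proof (rule integrable_cong_AE_imp)
  show "integrable lborel (\<lambda>\<xi>::'a. norm \<xi> powr 0 * exp (- (norm \<xi> powr \<beta>)))"
    by (rule integrable_norm_powr_mult_exp) (use assms in auto)
  show "AE \<xi> in lborel. norm \<xi> powr 0 * exp (- (norm \<xi> powr \<beta>)) = exp (- (norm (\<xi>::'a) powr \<beta>))"
    using AE_lborel_singleton[of 0] by eventually_elim simp
qed measurable

section \<open>The stable characteristic function as a limit of exponential mixtures\<close>

definition has_radially_log_convex_fourier :: "('a::euclidean_space \<Rightarrow> real) \<Rightarrow> bool" where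
  "has_radially_log_convex_fourier f \<longleftrightarrow>
     (\<exists>P. radially_log_convex P \<and> (\<forall>x. fourier f x = complex_of_real (P x)))"

text \<open>Dominated convergence turns pointwise convergence of the functions into pointwise convergence of their
  Fourier transforms. The origin is exempted because it corresponds to the boundary point \<open>z = 1\<close> of the
  binomial series of \<open>(1 - z)\<^sup>\<alpha>\<close> used below.\<close>

lemma has_radially_log_convex_fourier_limit:
  fixes g :: "'a::euclidean_space \<Rightarrow> real"
  assumes f: "\<And>n. has_radially_log_convex_fourier (f n)"
    and meas: "\<And>n. f n \<in> borel_measurable borel" "g \<in> borel_measurable borel"
    and w: "integrable lborel w" "\<And>n x. x \<noteq> 0 \<Longrightarrow> \<bar>f n x\<bar> \<le> w x"
    and lim: "\<And>x. x \<noteq> 0 \<Longrightarrow> (\<lambda>n. f n x) \<longlonglongrightarrow> g x"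
  shows "has_radially_log_convex_fourier g"
proof -
  from f have "\<exists>P. radially_log_convex P \<and> (\<forall>x. fourier (f n) x = complex_of_real (P x))" for n
    by (simp add: has_radially_log_convex_fourier_def)
  then obtain P where P: "\<And>n. radially_log_convex (P n)" "\<And>n x. fourier (f n) x = complex_of_real (P n x)"
    by metis
  have AE: "AE x in lborel. x \<noteq> (0::'a)" by (rule AE_lborel_singleton)
  have conv: "(\<lambda>n. fourier (f n) x) \<longlonglongrightarrow> fourier g x" for x
    unfolding fourier_def
  proof (rule integral_dominated_convergence[OF _ _ w(1)])
    show "AE y in lborel. (\<lambda>n. complex_of_real (f n y) * exp (- \<i> * complex_of_real (y \<bullet> x)))
        \<longlonglongrightarrow> complex_of_real (g y) * exp (- \<i> * complex_of_real (y \<bullet> x))"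
      using AE by eventually_elim (intro tendsto_intros lim)
    show "AE y in lborel. norm (complex_of_real (f n y) * exp (- \<i> * complex_of_real (y \<bullet> x))) \<le> w y" for n
      using AE by eventually_elim (use w(2) in \<open>auto simp: norm_mult\<close>)
  qed (use meas in \<open>simp_all\<close>)
  have re: "(\<lambda>n. P n x) \<longlonglongrightarrow> Re (fourier g x)" and im: "Im (fourier g x) = 0" for x
  proof -
    show "(\<lambda>n. P n x) \<longlonglongrightarrow> Re (fourier g x)"
      using tendsto_Re[OF conv[of x]] by (simp add: P)
    have "(\<lambda>n. 0) \<longlonglongrightarrow> Im (fourier g x)"
      using tendsto_Im[OF conv[of x]] by (simp add: P)
    then show "Im (fourier g x) = 0" by (simp add: LIMSEQ_const_iff)
  qed
  have "radially_log_convex (\<lambda>x. Re (fourier g x))"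
    by (rule radially_log_convex_limit[OF P(1) re])
  with im show ?thesis
    unfolding has_radially_log_convex_fourier_def
    by (intro exI[of _ "\<lambda>x. Re (fourier g x)"]) (auto simp: complex_eq_iff)
qed

text \<open>For \<open>0 < \<alpha> < 1\<close> the binomial coefficients \<open>\<alpha>(\<alpha> - 1) \<cdots> (\<alpha> - k)/(k + 1)!\<close> alternate in sign, because all
  factors but the first are negative.\<close>

lemma sibuya_coeff_nonneg:
  fixes \<alpha> :: real
  assumes "0 < \<alpha>" "\<alpha> < 1"
  shows "0 \<le> - ((\<alpha> gchoose Suc k) * (-1) ^ Suc k)"
proof (induction k)
  case 0
  then show ?case using assms by simp
next
  case (Suc k)
  have "real (Suc (Suc k)) * (\<alpha> gchoose Suc (Suc k)) = (\<alpha> - real (Suc k)) * (\<alpha> gchoose Suc k)"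
    using gbinomial_mult_1[of \<alpha> "Suc k"] by (simp add: algebra_simps)
  then have *: "\<alpha> gchoose Suc (Suc k) = (\<alpha> - real (Suc k)) * (\<alpha> gchoose Suc k) / real (Suc (Suc k))"
    by (simp add: field_simps)
  then have "- ((\<alpha> gchoose Suc (Suc k)) * (-1) ^ Suc (Suc k))
     = (real (Suc k) - \<alpha>) / real (Suc (Suc k)) * (- ((\<alpha> gchoose Suc k) * (-1) ^ Suc k))"
    unfolding * power_Suc[of "-1" "Suc k"] divide_inverse by algebra
  also have "\<dots> \<ge> 0"
    by (rule mult_nonneg_nonneg[OF _ Suc.IH]) (use assms in simp)
  finally show ?case .
qed

lemma sibuya_sums:
  fixes \<alpha> z :: real
  assumes "0 \<le> z" "z < 1"
  shows "(\<lambda>k. - ((\<alpha> gchoose Suc k) * (-1) ^ Suc k) * z ^ Suc k) sums (1 - (1 - z) powr \<alpha>)"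
proof -
  have "(\<lambda>n. (\<alpha> gchoose n) * (- z) ^ n) sums (1 + - z) powr \<alpha>"
    using assms by (intro gen_binomial_real) auto
  then have "(\<lambda>n. (\<alpha> gchoose Suc n) * (- z) ^ Suc n) sums ((1 + - z) powr \<alpha> - (\<alpha> gchoose 0) * (- z) ^ 0)"
    by (subst sums_Suc_iff) simp
  from sums_minus[OF this] show ?thesis
    by (simp add: power_minus[of z] mult_ac)
qed

text \<open>For small \<open>u\<close>, \<open>(1 - exp(-ux))\<^sup>\<alpha> \<approx> u\<^sup>\<alpha> x\<^sup>\<alpha>\<close>, and \<open>u\<^sup>\<alpha>\<close> is \<open>1/(n + 1)\<close> for the chosen scale.\<close>

lemma sibuya_scaling_limit:
  fixes \<alpha> x :: real
  assumes "0 < \<alpha>" "\<alpha> < 1" "x > 0"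
  shows "(\<lambda>n. (1 - (1 - exp (- (real (Suc n) powr (- 1 / \<alpha>) * x))) powr \<alpha>) ^ Suc n) \<longlonglongrightarrow> exp (- (x powr \<alpha>))"
  using assms by real_asymp

text \<open>Three limits lead from finite mixtures to \<open>exp(-\<bar>\<xi>\<bar>\<^sup>\<beta>)\<close>: the partial sums of the Sibuya generating
  function, the scaling limit of its powers, and the removal of the Gaussian damping. The first two are dominated by
  the Gaussian, the last one by \<open>exp(-\<bar>\<xi>\<bar>\<^sup>\<beta>)\<close> itself.\<close>

lemma stable_radially_log_convex_fourier:
  assumes "0 < \<beta>" "\<beta> < 2"
  shows "has_radially_log_convex_fourier (\<lambda>\<xi>::'a::euclidean_space. exp (- (norm \<xi> powr \<beta>)))"
proof -
  define \<alpha> where "\<alpha> = \<beta> / 2"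
  have \<alpha>: "0 < \<alpha>" "\<alpha> < 1" using assms by (auto simp: \<alpha>_def)
  define a where "a k = - ((\<alpha> gchoose Suc k) * (-1) ^ Suc k)" for k
  have a: "a k \<ge> 0" for k unfolding a_def by (rule sibuya_coeff_nonneg[OF \<alpha>])
  have gauss_int: "integrable lborel (\<lambda>\<xi>::'a. exp (- \<delta> * (norm \<xi>)\<^sup>2))" if "\<delta> > 0" for \<delta>
    by (rule gaussian_fourier[OF that])
  have step1: "has_radially_log_convex_fourier
      (\<lambda>\<xi>::'a. exp (- \<delta> * (norm \<xi>)\<^sup>2) * (\<Sum>k<K. a k * exp (- c * (norm \<xi>)\<^sup>2) ^ Suc k) ^ N)"
    if "\<delta> > 0" "c > 0" for \<delta> c K N
  proof -
    have "exp_mixture (\<lambda>x. (\<Sum>k<K. a k * exp (- (c * Suc k) * x)) ^ N)"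
      by (intro exp_mixture_power exp_mixture_sum exp_mixture_exp a) (use that in auto)
    moreover have "exp (- (c * Suc k) * x) = exp (- c * x) ^ Suc k" for k x
      unfolding exp_of_nat_mult[symmetric] by (simp add: mult_ac)
    ultimately have "exp_mixture (\<lambda>x. (\<Sum>k<K. a k * exp (- c * x) ^ Suc k) ^ N)"
      by simp
    from fourier_exp_mixture[OF this \<open>\<delta> > 0\<close>, where 'a = 'a] obtain h where "exp_mixture h"
      "\<And>x::'a. fourier (\<lambda>\<xi>. exp (- \<delta> * (norm \<xi>)\<^sup>2) * (\<Sum>k<K. a k * exp (- c * (norm \<xi>)\<^sup>2) ^ Suc k) ^ N) x
       = complex_of_real (h ((norm x)\<^sup>2))" by blast
    then show ?thesis
      unfolding has_radially_log_convex_fourier_def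
      using radially_log_convex_exp_mixture by blast
  qed
  have step2: "has_radially_log_convex_fourier
      (\<lambda>\<xi>::'a. exp (- \<delta> * (norm \<xi>)\<^sup>2) * (1 - (1 - exp (- c * (norm \<xi>)\<^sup>2)) powr \<alpha>) ^ N)"
    if \<delta>: "\<delta> > 0" and c: "c > 0" for \<delta> c N
  proof (rule has_radially_log_convex_fourier_limit[OF step1[OF \<delta> c] _ _ gauss_int[OF \<delta>]])
    fix x :: 'a assume "x \<noteq> 0"
    then have "c * (norm x)\<^sup>2 > 0" using c by simp
    then have "exp (- c * (norm x)\<^sup>2) < 1" by simp
    then have sums: "(\<lambda>k. a k * exp (- c * (norm x)\<^sup>2) ^ Suc k) sums (1 - (1 - exp (- c * (norm x)\<^sup>2)) powr \<alpha>)"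
      unfolding a_def by (intro sibuya_sums) auto
    then show "(\<lambda>K. exp (- \<delta> * (norm x)\<^sup>2) * (\<Sum>k<K. a k * exp (- c * (norm x)\<^sup>2) ^ Suc k) ^ N)
      \<longlonglongrightarrow> exp (- \<delta> * (norm x)\<^sup>2) * (1 - (1 - exp (- c * (norm x)\<^sup>2)) powr \<alpha>) ^ N"
      unfolding sums_def by (intro tendsto_intros)
    fix K
    have "(\<Sum>k<K. a k * exp (- c * (norm x)\<^sup>2) ^ Suc k) \<le> 1 - (1 - exp (- c * (norm x)\<^sup>2)) powr \<alpha>"
      unfolding sums_unique[OF sums] by (rule sum_le_suminf) (use sums a in \<open>auto simp: sums_iff\<close>)
    also have "\<dots> \<le> 1" by simp
    finally have 1: "(\<Sum>k<K. a k * exp (- c * (norm x)\<^sup>2) ^ Suc k) \<le> 1" .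
    have 0: "0 \<le> (\<Sum>k<K. a k * exp (- c * (norm x)\<^sup>2) ^ Suc k)"
      by (intro sum_nonneg mult_nonneg_nonneg a) auto
    have "(\<Sum>k<K. a k * exp (- c * (norm x)\<^sup>2) ^ Suc k) ^ N \<le> 1"
      by (rule power_le_one[OF 0 1])
    with zero_le_power[OF 0, of N]
    show "\<bar>exp (- \<delta> * (norm x)\<^sup>2) * (\<Sum>k<K. a k * exp (- c * (norm x)\<^sup>2) ^ Suc k) ^ N\<bar>
        \<le> exp (- \<delta> * (norm x)\<^sup>2)"
      unfolding abs_mult abs_exp_cancel by (intro mult_left_le) simp_all
  qed measurable
  have step3: "has_radially_log_convex_fourier
      (\<lambda>\<xi>::'a. exp (- \<delta> * (norm \<xi>)\<^sup>2) * exp (- (norm \<xi> powr \<beta>)))"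
    if \<delta>: "\<delta> > 0" for \<delta>
  proof (rule has_radially_log_convex_fourier_limit[OF step2[OF \<delta>] _ _ gauss_int[OF \<delta>]])
    show "0 < real (Suc n) powr (- 1 / \<alpha>)" for n by simp
    fix x :: 'a assume x: "x \<noteq> 0"
    have "((norm x)\<^sup>2) powr \<alpha> = norm x powr \<beta>"
      using x by (simp add: \<alpha>_def powr_powr flip: powr_numeral)
    with sibuya_scaling_limit[OF \<alpha>, of "(norm x)\<^sup>2"] x
    show "(\<lambda>n. exp (- \<delta> * (norm x)\<^sup>2) *
        (1 - (1 - exp (- (real (Suc n) powr (- 1 / \<alpha>)) * (norm x)\<^sup>2)) powr \<alpha>) ^ Suc n)
      \<longlonglongrightarrow> exp (- \<delta> * (norm x)\<^sup>2) * exp (- (norm x powr \<beta>))"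
      by (intro tendsto_mult tendsto_const) (simp del: power_Suc of_nat_Suc)
    fix n
    define u where "u = (1 - exp (- (real (Suc n) powr (- 1 / \<alpha>)) * (norm x)\<^sup>2)) powr \<alpha>"
    have u: "0 \<le> u" "u \<le> 1"
      unfolding u_def using \<alpha> by (auto intro!: powr_le1)
    then have "(1 - u) ^ Suc n \<le> 1" "0 \<le> (1 - u) ^ Suc n"
      using power_le_one[of "1 - u" "Suc n"] zero_le_power[of "1 - u" "Suc n"] by (simp_all del: power_Suc)
    then have "\<bar>exp (- \<delta> * (norm x)\<^sup>2) * (1 - u) ^ Suc n\<bar> \<le> exp (- \<delta> * (norm x)\<^sup>2)"
      unfolding abs_mult abs_exp_cancel by (intro mult_left_le) (simp_all del: power_Suc)
    then show "\<bar>exp (- \<delta> * (norm x)\<^sup>2) *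
        (1 - (1 - exp (- (real (Suc n) powr (- 1 / \<alpha>)) * (norm x)\<^sup>2)) powr \<alpha>) ^ Suc n\<bar>
        \<le> exp (- \<delta> * (norm x)\<^sup>2)"
      by (simp only: u_def)
  qed measurable
  show ?thesis
  proof (rule has_radially_log_convex_fourier_limit[OF step3])
    show "0 < 1 / real (Suc n)" for n by simp
    show "integrable lborel (\<lambda>\<xi>::'a. exp (- (norm \<xi> powr \<beta>)))"
      by (rule integrable_exp_neg_norm_powr[OF assms(1)])
    show "(\<lambda>n. exp (- (1 / real (Suc n)) * (norm x)\<^sup>2) * exp (- (norm x powr \<beta>))) \<longlonglongrightarrow> exp (- (norm x powr \<beta>))"
      for x :: 'a
      by real_asymp
    show "\<bar>exp (- (1 / real (Suc n)) * (norm x)\<^sup>2) * exp (- (norm x powr \<beta>))\<bar> \<le> exp (- (norm x powr \<beta>))"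
      for x :: 'a and n
      unfolding abs_mult abs_exp_cancel by (intro mult_left_le_one_le) auto
  qed measurable
qed

section \<open>Fourier inversion by Gaussian regularisation\<close>

lemma lborel_integral_affine:
  fixes f :: "'a::euclidean_space \<Rightarrow> 'b::{banach, second_countable_topology}" and t :: 'a
  assumes [measurable]: "f \<in> borel_measurable borel" and c: "c \<noteq> 0"
  shows "integrable lborel (\<lambda>x. f (t + c *\<^sub>R x)) \<longleftrightarrow> integrable lborel f"
    and "(LINT x|lborel. f x) = \<bar>c\<bar> ^ DIM('a) *\<^sub>R (LINT x|lborel. f (t + c *\<^sub>R x))"
proof -
  have "integrable lborel f \<longleftrightarrow> integrable lborel (\<lambda>x. \<bar>c\<bar> ^ DIM('a) *\<^sub>R f (t + c *\<^sub>R x))"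
    by (subst lborel_affine[OF c, of t], subst integrable_density)
       (simp_all add: integrable_distr_eq)
  then show "integrable lborel (\<lambda>x. f (t + c *\<^sub>R x)) \<longleftrightarrow> integrable lborel f"
    using c integrable_scaleR_right[of "inverse (\<bar>c\<bar> ^ DIM('a))" lborel "\<lambda>x. \<bar>c\<bar> ^ DIM('a) *\<^sub>R f (t + c *\<^sub>R x)"]
    by auto
  show "(LINT x|lborel. f x) = \<bar>c\<bar> ^ DIM('a) *\<^sub>R (LINT x|lborel. f (t + c *\<^sub>R x))"
    by (subst lborel_affine[OF c, of t], subst integral_density)
       (simp_all add: integral_distr)
qed


text \<open>The classical heat kernel, with Fourier transform \<open>exp(-t\<bar>\<xi>\<bar>\<^sup>2)\<close>.\<close>

definition gauss_kernel :: "real \<Rightarrow> 'a::euclidean_space \<Rightarrow> real" where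
  "gauss_kernel t z = exp (- (norm z)\<^sup>2 / (4 * t)) / (4 * pi * t) powr (DIM('a) / 2)"

lemma gauss_kernel_nonneg: "0 \<le> gauss_kernel t z"
  by (simp add: gauss_kernel_def)

lemma gauss_kernel_measurable [measurable]: "gauss_kernel t \<in> borel_measurable borel"
  unfolding gauss_kernel_def[abs_def] by measurable

lemma gauss_kernel_integral:
  assumes "t > 0"
  shows "integrable lborel (gauss_kernel t :: 'a::euclidean_space \<Rightarrow> real)"
    and "(LINT z|lborel. gauss_kernel t (z::'a)) = 1"
proof -
  have s: "1 / (4 * t) > 0" using assms by simp
  have eq: "gauss_kernel t z = exp (- (1 / (4 * t)) * (norm z)\<^sup>2) / (4 * pi * t) powr (DIM('a) / 2)" for z :: 'a
    by (simp add: gauss_kernel_def)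
  show "integrable lborel (gauss_kernel t :: 'a \<Rightarrow> real)"
    unfolding eq[abs_def] by (intro integrable_divide gaussian_fourier s)
  have "complex_of_real (LINT z|lborel. exp (- (1 / (4 * t)) * (norm (z::'a))\<^sup>2))
      = fourier (\<lambda>z. exp (- (1 / (4 * t)) * (norm (z::'a))\<^sup>2)) 0"
    by (simp add: fourier_def)
  also have "\<dots> = complex_of_real ((4 * pi * t) powr (DIM('a) / 2))"
    unfolding gaussian_fourier(2)[OF s] by (simp add: mult_ac)
  finally have "(LINT z|lborel. exp (- (1 / (4 * t)) * (norm (z::'a))\<^sup>2)) = (4 * pi * t) powr (DIM('a) / 2)"
    by (simp only: of_real_eq_iff)
  then show "(LINT z|lborel. gauss_kernel t (z::'a)) = 1"
    unfolding eq using assms by simp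
qed

lemma gauss_kernel_shift_integral:
  assumes "t > 0"
  shows "integrable lborel (\<lambda>y::'a::euclidean_space. gauss_kernel t (x - y))"
    and "(LINT y|lborel. gauss_kernel t (x - y::'a)) = 1"
  using lborel_integral_affine[of "gauss_kernel t" "-1" x] gauss_kernel_integral[OF assms, where 'a = 'a]
  by simp_all

text \<open>The function need not be bounded, so away from \<open>x\<close> integrability of \<open>f\<close> is combined with the uniform
  smallness of the kernel, while the contribution of the constant \<open>f(x)\<close> is controlled by comparison with the kernel at
  time \<open>2t\<close>, whose total mass is \<open>1\<close>.\<close>

lemma approximate_identity:
  fixes f :: "'a::euclidean_space \<Rightarrow> real"
  assumes f: "integrable lborel f" and cont: "isCont f x"
  shows "(\<lambda>n. LINT y|lborel. f y * gauss_kernel (1 / real (Suc n)) (x - y)) \<longlonglongrightarrow> f x"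
proof (rule LIMSEQ_I)
  fix e :: real assume "e > 0"
  then obtain \<delta> where \<delta>: "\<delta> > 0" "\<And>y. norm (y - x) < \<delta> \<Longrightarrow> norm (f y - f x) < e / 2"
    using cont unfolding isCont_def LIM_def by (metis dist_norm half_gt_zero norm_zero cancel_comm_monoid_add_class.diff_cancel)
  have [measurable]: "f \<in> borel_measurable borel" using f by auto
  define D where "D = real DIM('a) / 2"
  \<comment> \<open>\<open>M\<close> bounds the kernel outside the ball of radius \<open>\<delta>\<close>, and \<open>N\<close> its ratio to the kernel at time \<open>2t\<close>\<close>
  define M where "M t = exp (- \<delta>\<^sup>2 / (4 * t)) / (4 * pi * t) powr D" for t
  define N where "N t = exp (- \<delta>\<^sup>2 / (8 * t)) * 2 powr D" for t
  define I where "I = (LINT y|lborel. \<bar>f y\<bar>)"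
  have bound: "\<bar>(LINT y|lborel. f y * gauss_kernel t (x - y)) - f x\<bar> \<le> e / 2 + I * M t + \<bar>f x\<bar> * N t" if t: "t > 0" for t
  proof -
    note K = gauss_kernel_shift_integral[OF t, of x]
    have "2 * t > 0" using t by simp
    note K2 = gauss_kernel_shift_integral[OF this, of x]
    have far: "gauss_kernel t z \<le> M t" "gauss_kernel t z \<le> N t * gauss_kernel (2 * t) z"
      if "\<delta> \<le> norm z" for z :: 'a
    proof -
      have sq: "\<delta>\<^sup>2 \<le> (norm z)\<^sup>2" using that \<delta> by (intro power_mono) auto
      then show "gauss_kernel t z \<le> M t"
        unfolding gauss_kernel_def M_def D_def using t
        by (intro divide_right_mono) (auto simp: divide_simps)
      have "exp (- (norm z)\<^sup>2 / (4 * t)) = exp (- (norm z)\<^sup>2 / (8 * t)) * exp (- (norm z)\<^sup>2 / (8 * t))"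
        unfolding mult_exp_exp using t by (simp add: field_simps)
      also have "\<dots> \<le> exp (- \<delta>\<^sup>2 / (8 * t)) * exp (- (norm z)\<^sup>2 / (8 * t))"
        using sq t by (intro mult_right_mono) (auto simp: divide_simps)
      finally have "exp (- (norm z)\<^sup>2 / (4 * t)) \<le> exp (- \<delta>\<^sup>2 / (8 * t)) * exp (- (norm z)\<^sup>2 / (8 * t))" .
      then have "gauss_kernel t z \<le> exp (- \<delta>\<^sup>2 / (8 * t)) * exp (- (norm z)\<^sup>2 / (8 * t)) / (4 * pi * t) powr D"
        unfolding gauss_kernel_def D_def by (intro divide_right_mono) auto
      also have "\<dots> = N t * gauss_kernel (2 * t) z"
      proof -
        have "(8 * (pi * t)) powr D = 2 powr D * (4 * pi * t) powr D"
          using t by (subst powr_mult[symmetric]) (auto simp: mult_ac)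
        then show ?thesis using t by (simp add: gauss_kernel_def N_def D_def[symmetric])
      qed
      finally show "gauss_kernel t z \<le> N t * gauss_kernel (2 * t) z" .
    qed
    have MN: "0 \<le> M t" "0 \<le> N t" by (auto simp: M_def N_def)
    have pt: "\<bar>f y - f x\<bar> * gauss_kernel t (x - y)
      \<le> e / 2 * gauss_kernel t (x - y) + \<bar>f y\<bar> * M t + \<bar>f x\<bar> * N t * gauss_kernel (2 * t) (x - y)" for y
    proof (cases "norm (y - x) < \<delta>")
      case True
      have "\<bar>f y - f x\<bar> * gauss_kernel t (x - y) \<le> e / 2 * gauss_kernel t (x - y)"
        using \<delta>(2)[OF True] by (intro mult_right_mono gauss_kernel_nonneg) auto
      moreover have "0 \<le> \<bar>f y\<bar> * M t" "0 \<le> \<bar>f x\<bar> * N t * gauss_kernel (2 * t) (x - y)"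
        using MN by (auto intro!: mult_nonneg_nonneg gauss_kernel_nonneg)
      ultimately show ?thesis by linarith
    next
      case False
      then have z: "\<delta> \<le> norm (x - y)" by (simp add: norm_minus_commute)
      have "\<bar>f y - f x\<bar> * gauss_kernel t (x - y) \<le> (\<bar>f y\<bar> + \<bar>f x\<bar>) * gauss_kernel t (x - y)"
        by (intro mult_right_mono gauss_kernel_nonneg) auto
      also have "\<dots> = \<bar>f y\<bar> * gauss_kernel t (x - y) + \<bar>f x\<bar> * gauss_kernel t (x - y)"
        by (simp add: distrib_right)
      also have "\<dots> \<le> \<bar>f y\<bar> * M t + \<bar>f x\<bar> * (N t * gauss_kernel (2 * t) (x - y))"
        by (intro add_mono mult_left_mono far z) auto
      finally show ?thesis
        using \<open>e > 0\<close> gauss_kernel_nonneg[of t "x - y"]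
        by (smt (verit, best) mult.assoc mult_nonneg_nonneg half_gt_zero)
    qed
    have fM: "integrable lborel (\<lambda>y. \<bar>f y\<bar> * M t)" using f by simp
    have int_rhs: "integrable lborel (\<lambda>y. e / 2 * gauss_kernel t (x - y) + \<bar>f y\<bar> * M t + \<bar>f x\<bar> * N t * gauss_kernel (2 * t) (x - y))"
      by (intro Bochner_Integration.integrable_add integrable_mult_right K K2 fM)
    have int_diff: "integrable lborel (\<lambda>y. (f y - f x) * gauss_kernel t (x - y))"
    proof (rule Bochner_Integration.integrable_bound[OF int_rhs])
      show "AE y in lborel. norm ((f y - f x) * gauss_kernel t (x - y))
        \<le> norm (e / 2 * gauss_kernel t (x - y) + \<bar>f y\<bar> * M t + \<bar>f x\<bar> * N t * gauss_kernel (2 * t) (x - y))"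
        using order_trans[OF pt abs_ge_self]
        by (intro AE_I2) (simp add: abs_mult abs_of_nonneg[OF gauss_kernel_nonneg])
    qed measurable
    have fK: "integrable lborel (\<lambda>y. f y * gauss_kernel t (x - y))"
      using Bochner_Integration.integrable_add[OF int_diff integrable_mult_right[OF K(1), of "f x"]]
      by (simp add: algebra_simps)
    have "(LINT y|lborel. f y * gauss_kernel t (x - y)) - f x
        = (LINT y|lborel. f y * gauss_kernel t (x - y)) - (LINT y|lborel. f x * gauss_kernel t (x - y))"
      using K by simp
    also have "\<dots> = (LINT y|lborel. (f y - f x) * gauss_kernel t (x - y))"
      using fK K by (subst Bochner_Integration.integral_diff[symmetric]) (auto simp: left_diff_distrib)
    finally have "\<bar>(LINT y|lborel. f y * gauss_kernel t (x - y)) - f x\<bar>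
        = \<bar>LINT y|lborel. (f y - f x) * gauss_kernel t (x - y)\<bar>" by simp
    also have "\<dots> \<le> (LINT y|lborel. \<bar>(f y - f x) * gauss_kernel t (x - y)\<bar>)"
      by (rule integral_abs_bound)
    also have "\<dots> \<le> (LINT y|lborel. e / 2 * gauss_kernel t (x - y) + \<bar>f y\<bar> * M t + \<bar>f x\<bar> * N t * gauss_kernel (2 * t) (x - y))"
    proof (intro integral_mono int_rhs integrable_abs int_diff)
      show "\<bar>(f y - f x) * gauss_kernel t (x - y)\<bar>
        \<le> e / 2 * gauss_kernel t (x - y) + \<bar>f y\<bar> * M t + \<bar>f x\<bar> * N t * gauss_kernel (2 * t) (x - y)" for y
        using pt[of y] by (simp add: abs_mult abs_of_nonneg[OF gauss_kernel_nonneg])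
    qed
    also have "\<dots> = e / 2 + I * M t + \<bar>f x\<bar> * N t"
    proof -
      have "(LINT y|lborel. e / 2 * gauss_kernel t (x - y) + \<bar>f y\<bar> * M t + \<bar>f x\<bar> * N t * gauss_kernel (2 * t) (x - y))
        = (LINT y|lborel. e / 2 * gauss_kernel t (x - y)) + (LINT y|lborel. \<bar>f y\<bar> * M t)
          + (LINT y|lborel. \<bar>f x\<bar> * N t * gauss_kernel (2 * t) (x - y))"
        by (subst Bochner_Integration.integral_add, (intro Bochner_Integration.integrable_add integrable_mult_right K K2 fM)+)+ simp
      then show ?thesis using K K2 by (simp add: I_def)
    qed
    finally show ?thesis .
  qed
  have "(\<lambda>n. I * M (1 / real (Suc n)) + \<bar>f x\<bar> * N (1 / real (Suc n))) \<longlonglongrightarrow> I * 0 + \<bar>f x\<bar> * 0"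
  proof (intro tendsto_intros)
    show "(\<lambda>n. M (1 / real (Suc n))) \<longlonglongrightarrow> 0"
      unfolding M_def using \<delta> by real_asymp
    show "(\<lambda>n. N (1 / real (Suc n))) \<longlonglongrightarrow> 0"
      unfolding N_def using \<delta> by real_asymp
  qed
  then have "\<forall>\<^sub>F n in sequentially. I * M (1 / real (Suc n)) + \<bar>f x\<bar> * N (1 / real (Suc n)) < e / 2"
    by (rule order_tendstoD) (use \<open>e > 0\<close> in simp)
  then obtain n0 where n0: "\<And>n. n \<ge> n0 \<Longrightarrow> I * M (1 / real (Suc n)) + \<bar>f x\<bar> * N (1 / real (Suc n)) < e / 2"
    by (auto simp: eventually_sequentially)
  have "norm ((LINT y|lborel. f y * gauss_kernel (1 / real (Suc n)) (x - y)) - f x) < e" if "n \<ge> n0" for n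
    using bound[of "1 / real (Suc n)"] n0[OF that] by simp
  then show "\<exists>n0. \<forall>n\<ge>n0. norm ((LINT y|lborel. f y * gauss_kernel (1 / real (Suc n)) (x - y)) - f x) < e"
    by blast
qed


lemma square_powr_half:
  fixes x :: real
  assumes "x > 0"
  shows "(x\<^sup>2) powr (real n / 2) = x ^ n"
proof -
  have "(x\<^sup>2) powr (real n / 2) = (x powr 2) powr (real n / 2)" using assms by simp
  also have "\<dots> = x powr real n" by (simp add: powr_powr del: powr_numeral)
  finally show ?thesis using assms by (simp add: powr_realpow)
qed

text \<open>Fubini's theorem is applicable because the Gaussian factor makes the double integral absolutely
  convergent; the inner integral is a Gaussian Fourier transform. For \<open>x = 0\<close> this is Parseval's identity against a
  Gaussian.\<close>

lemma fourier_gaussian_regularization: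
  fixes f :: "'a::euclidean_space \<Rightarrow> real"
  assumes f: "integrable lborel f" and t: "t > 0"
  shows "(LINT \<xi>|lborel. fourier f \<xi> * (complex_of_real (exp (- t * (norm \<xi>)\<^sup>2)) * exp (\<i> * complex_of_real (x \<bullet> \<xi>))))
       = complex_of_real ((2 * pi) ^ DIM('a) * (LINT y|lborel. f y * gauss_kernel t (x - y)))"
proof -
  have [measurable]: "f \<in> borel_measurable borel" using f by auto
  define e where "e \<xi> = exp (- t * (norm (\<xi>::'a))\<^sup>2)" for \<xi>
  have e: "integrable lborel e" unfolding e_def[abs_def] by (rule gaussian_fourier[OF t])
  have [measurable]: "e \<in> borel_measurable borel" using e by auto
  define h where "h \<xi> y = (complex_of_real (f y) * exp (- \<i> * complex_of_real (y \<bullet> \<xi>)))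
      * (complex_of_real (e \<xi>) * exp (\<i> * complex_of_real (x \<bullet> \<xi>)))" for \<xi> y
  have h_norm: "norm (h \<xi> y) = \<bar>f y\<bar> * e \<xi>" for \<xi> y
    by (simp add: h_def norm_mult e_def)
  have h_meas: "(\<lambda>(\<xi>, y). h \<xi> y) \<in> borel_measurable (lborel \<Otimes>\<^sub>M lborel)"
    unfolding h_def by measurable
  have fy: "integrable lborel (\<lambda>y. h \<xi> y)" for \<xi>
    unfolding h_def by (intro integrable_mult_left integrable_fourier_integrand f)
  have h_int: "integrable (lborel \<Otimes>\<^sub>M lborel) (\<lambda>(\<xi>, y). h \<xi> y)"
  proof (rule lborel_pair.Fubini_integrable[OF h_meas])
    show "integrable lborel (\<lambda>\<xi>. LINT y|lborel. norm ((\<lambda>(\<xi>, y). h \<xi> y) (\<xi>, y)))"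
      using e by (simp add: h_norm)
    show "AE \<xi> in lborel. integrable lborel (\<lambda>y. (\<lambda>(\<xi>, y). h \<xi> y) (\<xi>, y))"
      using fy by simp
  qed
  have "(LINT \<xi>|lborel. fourier f \<xi> * (complex_of_real (e \<xi>) * exp (\<i> * complex_of_real (x \<bullet> \<xi>))))
      = (LINT \<xi>|lborel. LINT y|lborel. h \<xi> y)"
    by (simp add: h_def fourier_def)
  also have "\<dots> = (LINT y|lborel. LINT \<xi>|lborel. h \<xi> y)"
    by (rule lborel_pair.Fubini_integral[OF h_int, symmetric])
  also have "(\<lambda>y. LINT \<xi>|lborel. h \<xi> y) = (\<lambda>y. complex_of_real ((2 * pi) ^ DIM('a) * (f y * gauss_kernel t (x - y))))"
  proof
    fix y
    have "h \<xi> y = complex_of_real (f y) * (complex_of_real (e \<xi>) * exp (- \<i> * complex_of_real (\<xi> \<bullet> (y - x))))" for \<xi>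
    proof -
      have "exp (- \<i> * complex_of_real (\<xi> \<bullet> (y - x)))
          = exp (- \<i> * complex_of_real (y \<bullet> \<xi>)) * exp (\<i> * complex_of_real (x \<bullet> \<xi>))"
        unfolding mult_exp_exp by (simp add: inner_diff_right algebra_simps inner_commute)
      then show ?thesis by (simp add: h_def)
    qed
    then have "(LINT \<xi>|lborel. h \<xi> y) = complex_of_real (f y) * fourier e (y - x)"
      by (simp add: fourier_def)
    also have "fourier e (y - x) = complex_of_real ((pi / t) powr (DIM('a) / 2) * exp (- (norm (y - x))\<^sup>2 / (4 * t)))"
      unfolding e_def[abs_def] by (rule gaussian_fourier[OF t])
    also have "(pi / t) powr (DIM('a) / 2) * exp (- (norm (y - x))\<^sup>2 / (4 * t)) = (2 * pi) ^ DIM('a) * gauss_kernel t (x - y)"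
    proof -
      have "(pi / t) powr (DIM('a) / 2) * (4 * pi * t) powr (DIM('a) / 2) = ((2 * pi)\<^sup>2) powr (DIM('a) / 2)"
        using t by (subst powr_mult[symmetric]) (auto simp: power2_eq_square mult_ac)
      also have "\<dots> = (2 * pi) ^ DIM('a)"
        by (rule square_powr_half) simp
      finally show ?thesis
        using t by (simp add: gauss_kernel_def norm_minus_commute field_simps)
    qed
    finally show "(LINT \<xi>|lborel. h \<xi> y) = complex_of_real ((2 * pi) ^ DIM('a) * (f y * gauss_kernel t (x - y)))"
      by simp
  qed
  finally show ?thesis
    by (simp only: e_def integral_complex_of_real integral_mult_right_zero)
qed

lemma fourier_continuous:
  fixes f :: "'a::euclidean_space \<Rightarrow> real"
  assumes f: "integrable lborel f"
  shows "continuous_on UNIV (fourier f)"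
proof -
  have [measurable]: "f \<in> borel_measurable borel" using f by auto
  have "isCont (fourier f) x" for x
    unfolding continuous_at_sequentially comp_def
  proof (intro allI impI)
    fix u :: "nat \<Rightarrow> 'a" assume u: "u \<longlonglongrightarrow> x"
    show "(\<lambda>n. fourier f (u n)) \<longlonglongrightarrow> fourier f x"
      unfolding fourier_def
    proof (rule integral_dominated_convergence[where w = "\<lambda>y. \<bar>f y\<bar>"])
      show "AE y in lborel. (\<lambda>n. complex_of_real (f y) * exp (- \<i> * complex_of_real (y \<bullet> u n)))
          \<longlonglongrightarrow> complex_of_real (f y) * exp (- \<i> * complex_of_real (y \<bullet> x))"
        by (intro AE_I2 tendsto_intros u)
    qed (use f in \<open>auto simp: norm_mult\<close>)
  qed
  then show ?thesis by (simp add: continuous_on_eq_continuous_at)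
qed

lemma fourier_norm_le: "norm (fourier f \<xi>) \<le> (LINT x|lborel. \<bar>f x\<bar>)"
  unfolding fourier_def by (rule order_trans[OF integral_norm_bound]) (simp add: norm_mult)

lemma fourier_inversion:
  fixes f :: "'a::euclidean_space \<Rightarrow> real"
  assumes f: "integrable lborel f" and F: "integrable lborel (fourier f)" and cont: "isCont f x"
  shows "(LINT \<xi>|lborel. fourier f \<xi> * exp (\<i> * complex_of_real (x \<bullet> \<xi>))) = complex_of_real ((2 * pi) ^ DIM('a) * f x)"
proof (rule LIMSEQ_unique)
  have [measurable]: "fourier f \<in> borel_measurable borel" using F by auto
  show "(\<lambda>n. LINT \<xi>|lborel. fourier f \<xi> * (complex_of_real (exp (- (1 / real (Suc n)) * (norm \<xi>)\<^sup>2))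
      * exp (\<i> * complex_of_real (x \<bullet> \<xi>)))) \<longlonglongrightarrow> complex_of_real ((2 * pi) ^ DIM('a) * f x)"
    by (subst fourier_gaussian_regularization[OF f])
       (simp, intro tendsto_of_real tendsto_mult tendsto_const approximate_identity f cont)
  show "(\<lambda>n. LINT \<xi>|lborel. fourier f \<xi> * (complex_of_real (exp (- (1 / real (Suc n)) * (norm \<xi>)\<^sup>2))
      * exp (\<i> * complex_of_real (x \<bullet> \<xi>))))
    \<longlonglongrightarrow> (LINT \<xi>|lborel. fourier f \<xi> * exp (\<i> * complex_of_real (x \<bullet> \<xi>)))"
  proof (rule integral_dominated_convergence[where w = "\<lambda>\<xi>. norm (fourier f \<xi>)"])
    show "AE \<xi> in lborel. (\<lambda>n. fourier f \<xi> * (complex_of_real (exp (- (1 / real (Suc n)) * (norm \<xi>)\<^sup>2))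
        * exp (\<i> * complex_of_real (x \<bullet> \<xi>)))) \<longlonglongrightarrow> fourier f \<xi> * exp (\<i> * complex_of_real (x \<bullet> \<xi>))"
    proof (rule AE_I2)
      fix \<xi> :: 'a
      have "(\<lambda>n. exp (- (1 / real (Suc n)) * (norm \<xi>)\<^sup>2)) \<longlonglongrightarrow> 1" by real_asymp
      from tendsto_of_real[OF this, where 'a = complex]
      have "(\<lambda>n. fourier f \<xi> * (complex_of_real (exp (- (1 / real (Suc n)) * (norm \<xi>)\<^sup>2))
        * exp (\<i> * complex_of_real (x \<bullet> \<xi>)))) \<longlonglongrightarrow> fourier f \<xi> * (complex_of_real 1 * exp (\<i> * complex_of_real (x \<bullet> \<xi>)))"
        by (intro tendsto_mult tendsto_const)
      then show "(\<lambda>n. fourier f \<xi> * (complex_of_real (exp (- (1 / real (Suc n)) * (norm \<xi>)\<^sup>2))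
        * exp (\<i> * complex_of_real (x \<bullet> \<xi>)))) \<longlonglongrightarrow> fourier f \<xi> * exp (\<i> * complex_of_real (x \<bullet> \<xi>))"
        by simp
    qed
    show "AE \<xi> in lborel. norm (fourier f \<xi> * (complex_of_real (exp (- (1 / real (Suc n)) * (norm \<xi>)\<^sup>2))
        * exp (\<i> * complex_of_real (x \<bullet> \<xi>)))) \<le> norm (fourier f \<xi>)" for n
      by (intro AE_I2) (simp add: norm_mult mult_left_le)
    show "integrable lborel (\<lambda>\<xi>. norm (fourier f \<xi>))" using F by (rule integrable_norm)
  qed measurable
qed

text \<open>The Gaussian means \<open>\<integral> P exp(-t\<bar>\<xi>\<bar>\<^sup>2)\<close> converge to \<open>(2\<pi>)\<^sup>d f(0)\<close> as \<open>t \<rightarrow> 0\<close> by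
  regularisation, and for \<open>P \<ge> 0\<close> they increase, so that monotone convergence applies.\<close>

lemma integrable_of_fourier_nonneg:
  fixes f P :: "'a::euclidean_space \<Rightarrow> real"
  assumes f: "integrable lborel f" and cont: "isCont f 0"
    and P: "\<And>\<xi>. fourier f \<xi> = complex_of_real (P \<xi>)" "\<And>\<xi>. 0 \<le> P \<xi>"
  shows "integrable lborel P"
proof (rule integrable_monotone_convergence)
  have "continuous_on UNIV (\<lambda>\<xi>. Re (fourier f \<xi>))"
    by (intro continuous_on_Re fourier_continuous f)
  then have [measurable]: "P \<in> borel_measurable borel"
    by (simp add: P borel_measurable_continuous_onI)
  then show "P \<in> borel_measurable lborel" by simp
  let ?u = "\<lambda>n \<xi>. P \<xi> * exp (- (1 / real (Suc n)) * (norm \<xi>)\<^sup>2)"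
  have Pb: "\<bar>P \<xi>\<bar> \<le> (LINT x|lborel. \<bar>f x\<bar>)" for \<xi>
    using fourier_norm_le[of f \<xi>] by (simp add: P)
  show "integrable lborel (?u n)" for n
  proof (rule Bochner_Integration.integrable_bound)
    show "integrable lborel (\<lambda>\<xi>::'a. (LINT x|lborel. \<bar>f x\<bar>) * exp (- (1 / real (Suc n)) * (norm \<xi>)\<^sup>2))"
      by (intro integrable_mult_right gaussian_fourier) simp
    show "AE \<xi> in lborel. norm (?u n \<xi>) \<le> norm ((LINT x|lborel. \<bar>f x\<bar>) * exp (- (1 / real (Suc n)) * (norm \<xi>)\<^sup>2))"
      using order_trans[OF Pb abs_ge_self] by (intro AE_I2) (simp add: abs_mult)
  qed measurable
  show "AE \<xi> in lborel. mono (\<lambda>n. ?u n \<xi>)"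
    using P(2) by (intro AE_I2 monoI mult_left_mono) (auto simp: divide_simps mult_left_mono)
  show "AE \<xi> in lborel. (\<lambda>n. ?u n \<xi>) \<longlonglongrightarrow> P \<xi>"
  proof (rule AE_I2)
    fix \<xi> :: 'a
    have "(\<lambda>n. exp (- (1 / real (Suc n)) * (norm \<xi>)\<^sup>2)) \<longlonglongrightarrow> 1" by real_asymp
    from tendsto_mult[OF tendsto_const this] show "(\<lambda>n. ?u n \<xi>) \<longlonglongrightarrow> P \<xi>" by simp
  qed
  have "(LINT \<xi>|lborel. ?u n \<xi>) = (2 * pi) ^ DIM('a) * (LINT y|lborel. f y * gauss_kernel (1 / real (Suc n)) (0 - y))" for n
  proof -
    have "complex_of_real (LINT \<xi>|lborel. ?u n \<xi>) = (LINT \<xi>|lborel. fourier f \<xi> *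
        (complex_of_real (exp (- (1 / real (Suc n)) * (norm \<xi>)\<^sup>2)) * exp (\<i> * complex_of_real (0 \<bullet> \<xi>))))"
      by (simp add: P flip: integral_complex_of_real)
    also have "\<dots> = complex_of_real ((2 * pi) ^ DIM('a) * (LINT y|lborel. f y * gauss_kernel (1 / real (Suc n)) (0 - y)))"
      by (rule fourier_gaussian_regularization[OF f]) simp
    finally show ?thesis by (simp only: of_real_eq_iff)
  qed
  then show "(\<lambda>n. LINT \<xi>|lborel. ?u n \<xi>) \<longlonglongrightarrow> (2 * pi) ^ DIM('a) * f 0"
    by (simp only:) (intro tendsto_mult tendsto_const approximate_identity f cont)
qed

section \<open>The fractional heat kernel\<close>

text \<open>The candidate is the Fourier transform of \<open>exp(-\<bar>\<xi>\<bar>\<^sup>\<beta>)\<close> divided by \<open>(2\<pi>)\<^sup>d\<close>. It is nonnegative by radial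
  log-convexity, hence integrable, and inversion gives back its Fourier transform because \<open>exp(-\<bar>\<xi>\<bar>\<^sup>\<beta>)\<close> is even. Any
  other candidate is given by the same inversion integral.\<close>

lemma Phi_properties:
  assumes \<beta>: "0 < \<beta>" "\<beta> < 2"
  shows Phi_continuous: "continuous_on UNIV (Phi \<beta> :: 'a::euclidean_space \<Rightarrow> real)"
    and Phi_integrable: "integrable lborel (Phi \<beta> :: 'a \<Rightarrow> real)"
    and Phi_fourier: "\<And>\<xi>::'a. fourier (Phi \<beta>) \<xi> = complex_of_real (exp (- (norm \<xi> powr \<beta>)))"
    and Phi_radially_log_convex: "radially_log_convex (Phi \<beta> :: 'a \<Rightarrow> real)"
    and Phi_eq_cos_integral:
      "\<And>x::'a. (2 * pi) ^ DIM('a) * Phi \<beta> x = (LINT \<xi>|lborel. exp (- (norm \<xi> powr \<beta>)) * cos (x \<bullet> \<xi>))"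
proof -
  define G where "G \<xi> = exp (- (norm (\<xi>::'a) powr \<beta>))" for \<xi>
  have G_int: "integrable lborel G"
    unfolding G_def[abs_def] by (rule integrable_exp_neg_norm_powr) (use \<beta> in simp)
  have G_cont: "continuous_on UNIV G"
    unfolding G_def[abs_def] by (intro continuous_intros continuous_on_powr') (use \<beta> in auto)
  then have G_isCont: "isCont G x" for x by (simp add: continuous_on_eq_continuous_at)
  obtain P where P: "radially_log_convex P" "\<And>x. fourier G x = complex_of_real (P x)"
    using stable_radially_log_convex_fourier[OF \<beta>, where 'a = 'a]
    unfolding has_radially_log_convex_fourier_def G_def[abs_def] by blast
  have P_nonneg: "0 \<le> P x" for x using P(1) by (simp add: radially_log_convex_def)
  have P_int: "integrable lborel P"
    by (rule integrable_of_fourier_nonneg[OF G_int G_isCont P(2) P_nonneg])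
  have P_cont: "continuous_on UNIV P"
  proof -
    have "continuous_on UNIV (\<lambda>x. Re (fourier G x))"
      by (intro continuous_on_Re fourier_continuous G_int)
    then show ?thesis by (simp add: P)
  qed
  define c where "c = (2 * pi) ^ DIM('a)"
  have c: "c > 0" by (simp add: c_def)
  have "fourier G = (\<lambda>x. complex_of_real (P x))" using P by auto
  then have FG_int: "integrable lborel (fourier G)" using P_int by simp
  define p where "p x = P x / c" for x
  have p_fourier: "fourier p y = complex_of_real (G y)" for y
  proof -
    have "fourier p y = (LINT \<xi>|lborel. fourier G \<xi> * exp (\<i> * complex_of_real ((- y) \<bullet> \<xi>))) / complex_of_real c"
      unfolding fourier_def[of p] p_def
      by (simp add: P inner_commute flip: integral_divide_zero)
    also have "\<dots> = complex_of_real (G (- y))"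
      unfolding fourier_inversion[OF G_int FG_int G_isCont] using c by (simp add: c_def)
    finally show ?thesis by (simp add: G_def)
  qed
  have p: "continuous_on UNIV p \<and> integrable lborel p \<and> (\<forall>\<xi>. fourier p \<xi> = complex_of_real (exp (- 1 * norm \<xi> powr \<beta>)))"
    using c P_int P_cont p_fourier by (auto simp: p_def[abs_def] G_def intro!: continuous_intros)
  have uniq: "g = g'" if g: "continuous_on UNIV g \<and> integrable lborel g \<and> (\<forall>\<xi>. fourier g \<xi> = complex_of_real (exp (- 1 * norm \<xi> powr \<beta>)))"
    and g': "continuous_on UNIV g' \<and> integrable lborel g' \<and> (\<forall>\<xi>. fourier g' \<xi> = complex_of_real (exp (- 1 * norm \<xi> powr \<beta>)))"
    for g g' :: "'a \<Rightarrow> real"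
  proof
    fix x
    have val: "complex_of_real (c * g x) = (LINT \<xi>|lborel. complex_of_real (G \<xi>) * exp (\<i> * complex_of_real (x \<bullet> \<xi>)))"
      if g: "continuous_on UNIV g \<and> integrable lborel g \<and> (\<forall>\<xi>. fourier g \<xi> = complex_of_real (exp (- 1 * norm \<xi> powr \<beta>)))"
      for g :: "'a \<Rightarrow> real"
    proof -
      have fg: "fourier g = (\<lambda>\<xi>. complex_of_real (G \<xi>))" using g by (auto simp: G_def)
      have "isCont g x" using g by (simp add: continuous_on_eq_continuous_at)
      moreover have "integrable lborel (fourier g)" unfolding fg using G_int by simp
      ultimately show ?thesis
        using fourier_inversion[of g x] g unfolding fg c_def by simp
    qed
    from val[OF g] val[OF g'] have "c * g x = c * g' x" by (metis of_real_eq_iff)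
    then show "g x = g' x" using c by simp
  qed
  have Phi_p: "Phi \<beta> = p"
    unfolding Phi_def[abs_def] frac_heat_kernel_def
    by (rule the_equality, rule p, rule uniq[OF _ p])
  show "continuous_on UNIV (Phi \<beta> :: 'a \<Rightarrow> real)" "integrable lborel (Phi \<beta> :: 'a \<Rightarrow> real)"
    "\<And>\<xi>::'a. fourier (Phi \<beta>) \<xi> = complex_of_real (exp (- (norm \<xi> powr \<beta>)))"
    using p p_fourier unfolding Phi_p G_def by auto
  show "radially_log_convex (Phi \<beta> :: 'a \<Rightarrow> real)"
    using radially_log_convex_cmult[OF P(1), of "1 / c"] c unfolding Phi_p p_def[abs_def] by simp
  show "(2 * pi) ^ DIM('a) * Phi \<beta> x = (LINT \<xi>|lborel. exp (- (norm \<xi> powr \<beta>)) * cos (x \<bullet> \<xi>))" for x :: 'a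
  proof -
    have "(2 * pi) ^ DIM('a) * Phi \<beta> x = P x" using c by (simp add: Phi_p p_def c_def)
    also have "\<dots> = Re (fourier G x)" by (simp add: P)
    also have "\<dots> = (LINT \<xi>|lborel. Re (complex_of_real (G \<xi>) * exp (- \<i> * complex_of_real (\<xi> \<bullet> x))))"
      unfolding fourier_def by (rule integral_Re[symmetric]) (rule integrable_fourier_integrand[OF G_int])
    also have "\<dots> = (LINT \<xi>|lborel. exp (- (norm \<xi> powr \<beta>)) * cos (x \<bullet> \<xi>))"
      by (simp add: Re_exp G_def inner_commute)
    finally show ?thesis .
  qed
qed

lemmas Phi_nonneg = Phi_radially_log_convex[THEN radially_log_convex_nonneg]
lemmas Phi_antimono = Phi_radially_log_convex[THEN radially_log_convex_antimono]
lemmas Phi_spread = Phi_radially_log_convex[THEN radially_log_convex_spread]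

lemma Phi_integral:
  assumes "0 < \<beta>" "\<beta> < 2"
  shows "(LINT x|lborel. Phi \<beta> (x::'a::euclidean_space)) = 1"
proof -
  have "complex_of_real (LINT x|lborel. Phi \<beta> (x::'a)) = fourier (Phi \<beta>) (0::'a)"
    by (simp add: fourier_def)
  also have "\<dots> = 1" by (simp add: Phi_fourier[OF assms])
  finally show ?thesis by simp
qed

text \<open>Parseval's identity against a Gaussian, followed by the substitution \<open>\<xi> = \<surd>t z\<close>. It gives
  access to the decay of \<open>\<Phi>\<close> through the behaviour of \<open>exp(-\<bar>\<xi>\<bar>\<^sup>\<beta>)\<close> near the origin.\<close>

lemma Phi_laplace:
  assumes \<beta>: "0 < \<beta>" "\<beta> < 2" and t: "t > 0"
  shows "(LINT y|lborel. Phi \<beta> y * exp (- t * (norm (y::'a::euclidean_space))\<^sup>2))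
    = (LINT z|lborel. exp (- (t powr (\<beta> / 2) * norm (z::'a) powr \<beta>)) * gauss_kernel 1 z)"
proof -
  define D where "D = real DIM('a) / 2"
  define s where "s = 1 / (4 * t)"
  have s: "s > 0" using t by (simp add: s_def)
  have "complex_of_real (LINT \<xi>|lborel. exp (- (norm (\<xi>::'a) powr \<beta>)) * exp (- s * (norm \<xi>)\<^sup>2))
      = (LINT \<xi>|lborel. fourier (Phi \<beta>) \<xi> * (complex_of_real (exp (- s * (norm \<xi>)\<^sup>2)) * exp (\<i> * complex_of_real ((0::'a) \<bullet> \<xi>))))"
    by (simp add: Phi_fourier[OF \<beta>] flip: integral_complex_of_real)
  also have "\<dots> = complex_of_real ((2 * pi) ^ DIM('a) * (LINT y|lborel. Phi \<beta> (y::'a) * gauss_kernel s (0 - y)))"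
    by (rule fourier_gaussian_regularization[OF Phi_integrable[OF \<beta>] s])
  finally have reg: "(LINT \<xi>|lborel. exp (- (norm (\<xi>::'a) powr \<beta>)) * exp (- s * (norm \<xi>)\<^sup>2))
      = (2 * pi) ^ DIM('a) * (LINT y|lborel. Phi \<beta> (y::'a) * gauss_kernel s (0 - y))"
    by (simp only: of_real_eq_iff)
  have k1: "gauss_kernel s (0 - y) = exp (- t * (norm y)\<^sup>2) / (pi / t) powr D" for y :: 'a
    using t by (simp add: gauss_kernel_def s_def D_def)
  have k2: "exp (- s * (norm \<xi>)\<^sup>2) = (4 * pi * t) powr D * gauss_kernel t \<xi>" for \<xi> :: 'a
    using t by (simp add: gauss_kernel_def s_def D_def)
  have "(pi / t) powr D * (4 * pi * t) powr D = ((2 * pi)\<^sup>2) powr D"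
    using t by (subst powr_mult[symmetric]) (auto simp: power2_eq_square mult_ac)
  also have "\<dots> = (2 * pi) ^ DIM('a)"
    unfolding D_def by (rule square_powr_half) simp
  finally have pp: "(pi / t) powr D * (4 * pi * t) powr D = (2 * pi) ^ DIM('a)" .
  have "(4 * pi * t) powr D * (LINT \<xi>|lborel. exp (- (norm (\<xi>::'a) powr \<beta>)) * gauss_kernel t \<xi>)
      = (4 * pi * t) powr D * (LINT y|lborel. Phi \<beta> y * exp (- t * (norm (y::'a))\<^sup>2))"
  proof -
    have "(4 * pi * t) powr D * (LINT \<xi>|lborel. exp (- (norm (\<xi>::'a) powr \<beta>)) * gauss_kernel t \<xi>)
      = (LINT \<xi>|lborel. exp (- (norm (\<xi>::'a) powr \<beta>)) * exp (- s * (norm \<xi>)\<^sup>2))"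
      unfolding k2 by (simp add: mult.left_commute flip: integral_mult_right_zero)
    also have "\<dots> = (2 * pi) ^ DIM('a) * ((LINT y|lborel. Phi \<beta> y * exp (- t * (norm (y::'a))\<^sup>2)) / (pi / t) powr D)"
      unfolding reg k1 by simp
    also have "\<dots> = (4 * pi * t) powr D * (LINT y|lborel. Phi \<beta> y * exp (- t * (norm (y::'a))\<^sup>2))"
      unfolding pp[symmetric] using t by simp
    finally show ?thesis .
  qed
  then have "(LINT y|lborel. Phi \<beta> y * exp (- t * (norm (y::'a))\<^sup>2))
      = (LINT \<xi>|lborel. exp (- (norm (\<xi>::'a) powr \<beta>)) * gauss_kernel t \<xi>)"
    using t by simp
  also have "\<dots> = \<bar>sqrt t\<bar> ^ DIM('a) *\<^sub>R (LINT z|lborel. exp (- (norm (0 + sqrt t *\<^sub>R z :: 'a) powr \<beta>)) * gauss_kernel t (0 + sqrt t *\<^sub>R z))"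
    by (rule lborel_integral_affine(2)) (use t in auto)
  also have "\<dots> = (LINT z|lborel. exp (- (t powr (\<beta> / 2) * norm (z::'a) powr \<beta>)) * gauss_kernel 1 z)"
  proof -
    have "sqrt t ^ DIM('a) * gauss_kernel t (sqrt t *\<^sub>R z) = gauss_kernel 1 z" for z :: 'a
    proof -
      have "sqrt t ^ DIM('a) = t powr D"
        using t by (simp add: powr_powr D_def powr_half_sqrt[symmetric] flip: powr_realpow)
      moreover have "(4 * pi * t) powr D = (4 * pi) powr D * t powr D"
        using t by (simp add: powr_mult)
      ultimately show ?thesis
        using t by (simp add: gauss_kernel_def D_def[symmetric] power_mult_distrib)
    qed
    note K = this
    have N: "norm (sqrt t *\<^sub>R z) powr \<beta> = t powr (\<beta> / 2) * norm z powr \<beta>" for z :: 'a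
      using t by (simp add: powr_mult powr_powr powr_half_sqrt[symmetric])
    have "sqrt t ^ DIM('a) * (exp (- (norm (0 + sqrt t *\<^sub>R z :: 'a) powr \<beta>)) * gauss_kernel t (0 + sqrt t *\<^sub>R z))
      = exp (- (t powr (\<beta> / 2) * norm z powr \<beta>)) * gauss_kernel 1 z" for z :: 'a
      unfolding add_0 N K[symmetric] by (simp only: mult.left_commute)
    then show ?thesis
      using t by (simp only: real_scaleR_def abs_of_pos real_sqrt_gt_zero integral_mult_right_zero[symmetric])
  qed
  finally show ?thesis .
qed

section \<open>Quantitative bounds for the heat kernel\<close>

text \<open>Put \<open>m(t) = \<integral> \<Phi>(y) exp(-t\<bar>y\<bar>\<^sup>2) dy\<close>. By \<open>Phi_laplace\<close>, \<open>m(\<kappa>t) - m(t) \<ge> c t\<^sup>\<beta>\<^sup>/\<^sup>2\<close> for \<open>0 < t \<le> 1\<close>, with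
  \<open>\<kappa>\<close> chosen so that \<open>(\<kappa>t)\<^sup>\<beta>\<^sup>/\<^sup>2 = t\<^sup>\<beta>\<^sup>/\<^sup>2/2\<close>. On the other hand, the part of this difference coming from \<open>\<bar>y\<bar> \<le> \<bar>x\<bar>\<close> is at
  most \<open>t\<bar>x\<bar>\<^sup>2\<close>, and on the complement \<open>\<Phi> \<le> \<Phi>(x)\<close>, which contributes at most \<open>\<Phi>(x) (\<pi>/(\<kappa>t))\<^sup>d\<^sup>/\<^sup>2\<close>. As \<open>\<beta> < 2\<close>, the term
  \<open>t\<bar>x\<bar>\<^sup>2\<close> is absorbed for \<open>t\<close> equal to a suitable negative power of \<open>\<bar>x\<bar>\<close>, and a polynomial lower bound for
  \<open>\<Phi>(x)\<close> remains.\<close>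

lemma Phi_polynomial_lower_bound:
  assumes \<beta>: "0 < \<beta>" "\<beta> < 2"
  shows "\<exists>C N. C > 0 \<and> N > 0 \<and> (\<forall>x::'a::euclidean_space. 1 \<le> norm x \<longrightarrow> C * norm x powr (- N) \<le> Phi \<beta> x)"
proof -
  define \<kappa> where "\<kappa> = 2 powr (- 2 / \<beta>)"
  have \<kappa>: "0 < \<kappa>" "\<kappa> \<le> 1" "\<kappa> powr (\<beta> / 2) = 1 / 2"
  proof -
    show "0 < \<kappa>" by (simp add: \<kappa>_def)
    show "\<kappa> \<le> 1" using powr_mono[of "- 2 / \<beta>" 0 2] \<beta> by (simp add: \<kappa>_def)
    have "- 2 / \<beta> * (\<beta> / 2) = - 1" using \<beta> by simp
    then have "\<kappa> powr (\<beta> / 2) = 2 powr (- 1)" by (simp only: \<kappa>_def powr_powr)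
    then show "\<kappa> powr (\<beta> / 2) = 1 / 2" by (simp add: powr_minus)
  qed
  define k where "k = (gauss_kernel 1 :: 'a \<Rightarrow> real)"
  have k: "integrable lborel k" "(LINT z|lborel. k z) = 1"
    unfolding k_def by (rule gauss_kernel_integral; simp)+
  have k_pos: "0 < k z" for z by (simp add: k_def gauss_kernel_def)
  have [measurable]: "k \<in> borel_measurable borel" by (simp add: k_def)
  define a where "a z = norm (z::'a) powr \<beta>" for z
  have [measurable]: "a \<in> borel_measurable borel" unfolding a_def[abs_def] by measurable
  have a0: "0 \<le> a z" for z by (simp add: a_def)
  have ek: "integrable lborel (\<lambda>z. exp (- (l * a z)) * k z)" if "l \<ge> 0" for l
    by (rule Bochner_Integration.integrable_bound[OF k(1)])
       (use that a0 k_pos in \<open>auto intro!: AE_I2 mult_left_le_one_le simp: abs_mult less_imp_le\<close>)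
  define c where "c = (LINT z|lborel. exp (- (1 / 2 * a z)) * k z) - (LINT z|lborel. exp (- (1 * a z)) * k z)"
  have c_eq: "c = (LINT z|lborel. exp (- (1 / 2 * a z)) * k z - exp (- (1 * a z)) * k z)"
    unfolding c_def by (rule Bochner_Integration.integral_diff[symmetric]) (rule ek, simp)+
  have c_pos: "c > 0"
  proof -
    define f where "f z = exp (- (1 / 2 * a z)) * k z - exp (- (1 * a z)) * k z" for z
    have f0: "0 \<le> f z" for z
      unfolding f_def left_diff_distrib[symmetric] using a0[of z] k_pos[of z]
      by (intro mult_nonneg_nonneg) auto
    have f: "integrable lborel f"
      unfolding f_def[abs_def] by (intro Bochner_Integration.integrable_diff ek) auto
    have c: "c = (LINT z|lborel. f z)" unfolding c_eq f_def ..
    have "c \<noteq> 0"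
    proof
      assume "c = 0"
      then have "AE z in lborel. f z = 0"
        using f0 unfolding c by (subst (asm) integral_nonneg_eq_0_iff_AE[OF f]) auto
      then have "AE z in lborel :: 'a measure. False"
        using AE_lborel_singleton[of 0]
      proof eventually_elim
        case (elim z)
        then have "a z > 0" by (simp add: a_def)
        then have "exp (- (1 * a z)) * k z < exp (- (1 / 2 * a z)) * k z"
          using k_pos by (intro mult_strict_right_mono) auto
        with elim show False unfolding f_def by linarith
      qed
      then have "ae_filter (lborel :: 'a measure) = bot" by (simp add: trivial_limit_def)
      then show False by (simp add: ae_filter_eq_bot_iff)
    qed
    moreover have "c \<ge> 0" unfolding c by (intro Bochner_Integration.integral_nonneg f0)
    ultimately show ?thesis by simp
  qed
  have c_le: "c \<le> 1"
  proof -
    have "c \<le> (LINT z|lborel. k z)"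
      unfolding c_eq
    proof (rule integral_mono)
      show "integrable lborel (\<lambda>z. exp (- (1 / 2 * a z)) * k z - exp (- (1 * a z)) * k z)"
        by (intro Bochner_Integration.integrable_diff ek) auto
      show "exp (- (1 / 2 * a z)) * k z - exp (- (1 * a z)) * k z \<le> k z" for z
      proof -
        have "exp (- (1 / 2 * a z)) * k z \<le> 1 * k z"
          using a0[of z] k_pos[of z] by (intro mult_right_mono) auto
        moreover have "0 \<le> exp (- (1 * a z)) * k z" using k_pos[of z] by simp
        ultimately show ?thesis by linarith
      qed
    qed (rule k)
    with k show ?thesis by simp
  qed
  define D where "D = real DIM('a) / 2"
  have ineq: "c * t powr (\<beta> / 2) \<le> t * (norm x)\<^sup>2 + Phi \<beta> x * (pi / (\<kappa> * t)) powr D"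
    if t: "0 < t" "t \<le> 1" for t and x :: 'a
  proof -
    define l where "l = t powr (\<beta> / 2)"
    have l: "0 < l" "l \<le> 1" using t \<beta> by (auto simp: l_def powr_le1)
    have \<kappa>t: "\<kappa> * t > 0" "\<kappa> * t \<le> t" using \<kappa> t by auto
    have Phi_e: "integrable lborel (\<lambda>y::'a. Phi \<beta> y * exp (- s * (norm y)\<^sup>2))" if "s > 0" for s
    proof (rule Bochner_Integration.integrable_bound[OF Phi_integrable[OF \<beta>]])
      show "AE y in lborel. norm (Phi \<beta> y * exp (- s * (norm y)\<^sup>2)) \<le> norm (Phi \<beta> (y::'a))"
        using that by (intro AE_I2) (simp add: abs_mult mult_left_le)
      show "(\<lambda>y::'a. Phi \<beta> y * exp (- s * (norm y)\<^sup>2)) \<in> borel_measurable lborel"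
        using borel_measurable_integrable[OF Phi_integrable[OF \<beta>, where 'a = 'a]] by measurable
    qed
    have "c * l \<le> (LINT z|lborel. exp (- (l / 2 * a z)) * k z) - (LINT z|lborel. exp (- (l * a z)) * k z)"
    proof -
      have "c * l = (LINT z|lborel. l * (exp (- (1 / 2 * a z)) * k z - exp (- (1 * a z)) * k z))"
        unfolding c_eq by simp
      also have "\<dots> \<le> (LINT z|lborel. exp (- (l / 2 * a z)) * k z - exp (- (l * a z)) * k z)"
      proof (rule integral_mono)
        show "integrable lborel (\<lambda>z. l * (exp (- (1 / 2 * a z)) * k z - exp (- (1 * a z)) * k z))"
          by (intro integrable_mult_right Bochner_Integration.integrable_diff ek) auto
        show "integrable lborel (\<lambda>z. exp (- (l / 2 * a z)) * k z - exp (- (l * a z)) * k z)"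
          using l by (intro Bochner_Integration.integrable_diff ek) auto
        show "l * (exp (- (1 / 2 * a z)) * k z - exp (- (1 * a z)) * k z)
          \<le> exp (- (l / 2 * a z)) * k z - exp (- (l * a z)) * k z" for z
        proof -
          define w where "w = a z / 2"
          have w: "w \<ge> 0" using a0[of z] by (simp add: w_def)
          \<comment> \<open>concavity of \<open>l \<mapsto> 1 - exp(-lw)\<close>, which vanishes at \<open>l = 0\<close>\<close>
          have cvx: "1 - exp (- (l * w)) \<ge> l * (1 - exp (- w))"
          proof -
            have "exp ((1 - l) *\<^sub>R 0 + l *\<^sub>R (- w)) \<le> (1 - l) * exp 0 + l * exp (- w)"
              using l by (intro convex_onD[OF exp_convex]) auto
            then show ?thesis by (simp add: algebra_simps)
          qed
          have "l * (exp (- w) * (1 - exp (- w))) = exp (- w) * (l * (1 - exp (- w)))" by simp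
          also have "\<dots> \<le> exp (- (l * w)) * (1 - exp (- (l * w)))"
            using cvx w l by (intro mult_mono) (auto simp: mult_left_le_one_le)
          finally have "l * (exp (- w) - exp (- (2 * w))) \<le> exp (- (l * w)) - exp (- (2 * (l * w)))"
            by (simp add: right_diff_distrib mult_exp_exp)
          then have "l * (exp (- w) - exp (- (2 * w))) * k z \<le> (exp (- (l * w)) - exp (- (2 * (l * w)))) * k z"
            using k_pos[of z] by (intro mult_right_mono) auto
          then show ?thesis by (simp add: w_def algebra_simps)
        qed
      qed
      also have "\<dots> = (LINT z|lborel. exp (- (l / 2 * a z)) * k z) - (LINT z|lborel. exp (- (l * a z)) * k z)"
        using l by (intro Bochner_Integration.integral_diff ek) auto
      finally show ?thesis .
    qed
    also have "(LINT z|lborel. exp (- (l * a z)) * k z) = (LINT y|lborel. Phi \<beta> y * exp (- t * (norm (y::'a))\<^sup>2))"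
      unfolding Phi_laplace[OF \<beta> t(1)] by (simp add: l_def a_def k_def)
    also have "(LINT z|lborel. exp (- (l / 2 * a z)) * k z) = (LINT y|lborel. Phi \<beta> y * exp (- (\<kappa> * t) * (norm (y::'a))\<^sup>2))"
    proof -
      have "(\<kappa> * t) powr (\<beta> / 2) = \<kappa> powr (\<beta> / 2) * t powr (\<beta> / 2)"
        using \<kappa>(1) t by (simp add: powr_mult)
      then have kl: "(\<kappa> * t) powr (\<beta> / 2) = l / 2" unfolding \<kappa>(3) l_def by simp
      show ?thesis
        unfolding Phi_laplace[OF \<beta> \<kappa>t(1)] kl by (simp only: a_def k_def)
    qed
    also have "(LINT y|lborel. Phi \<beta> y * exp (- (\<kappa> * t) * (norm (y::'a))\<^sup>2)) - (LINT y|lborel. Phi \<beta> y * exp (- t * (norm (y::'a))\<^sup>2))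
      = (LINT y|lborel. Phi \<beta> y * exp (- (\<kappa> * t) * (norm (y::'a))\<^sup>2) - Phi \<beta> y * exp (- t * (norm (y::'a))\<^sup>2))"
      by (rule Bochner_Integration.integral_diff[symmetric]) (rule Phi_e, use \<kappa>t t in simp)+
    also have "\<dots> \<le> (LINT y|lborel. t * (norm x)\<^sup>2 * Phi \<beta> y + Phi \<beta> x * exp (- (\<kappa> * t) * (norm (y::'a))\<^sup>2))"
    proof (rule integral_mono)
      show "integrable lborel (\<lambda>y::'a. Phi \<beta> y * exp (- (\<kappa> * t) * (norm y)\<^sup>2) - Phi \<beta> y * exp (- t * (norm y)\<^sup>2))"
        by (intro Bochner_Integration.integrable_diff Phi_e) (use \<kappa>t t in auto)
      show "integrable lborel (\<lambda>y::'a. t * (norm x)\<^sup>2 * Phi \<beta> y + Phi \<beta> x * exp (- (\<kappa> * t) * (norm y)\<^sup>2))"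
        by (intro Bochner_Integration.integrable_add integrable_mult_right Phi_integrable \<beta> gaussian_fourier \<kappa>t)
      fix y :: 'a
      define u where "u = t * (norm y)\<^sup>2"
      have u: "u \<ge> 0" using t by (simp add: u_def)
      have P0: "0 \<le> Phi \<beta> y" "0 \<le> Phi \<beta> x" by (rule Phi_nonneg[OF \<beta>])+
      have "Phi \<beta> y * (exp (- (\<kappa> * u)) - exp (- u)) \<le> t * (norm x)\<^sup>2 * Phi \<beta> y + Phi \<beta> x * exp (- (\<kappa> * u))"
      proof (cases "norm y \<le> norm x")
        case True
        have "exp (- (\<kappa> * u)) - exp (- u) \<le> u"
          using exp_ge_add_one_self[of "- u"] \<kappa> u one_le_exp_iff[of "- (\<kappa> * u)"] exp_le_one_iff[of "- (\<kappa> * u)"]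
          by (smt (verit, best) mult_nonneg_nonneg)
        also have "u \<le> t * (norm x)\<^sup>2"
          unfolding u_def using True t by (intro mult_left_mono power_mono) auto
        finally have "Phi \<beta> y * (exp (- (\<kappa> * u)) - exp (- u)) \<le> Phi \<beta> y * (t * (norm x)\<^sup>2)"
          by (rule mult_left_mono[OF _ P0(1)])
        moreover have "0 \<le> Phi \<beta> x * exp (- (\<kappa> * u))" using P0 by simp
        ultimately show ?thesis by (simp add: mult_ac)
      next
        case False
        then have "Phi \<beta> y \<le> Phi \<beta> x" by (intro Phi_antimono \<beta>) auto
        moreover have "exp (- (\<kappa> * u)) - exp (- u) \<le> exp (- (\<kappa> * u))" by simp
        ultimately have "Phi \<beta> y * (exp (- (\<kappa> * u)) - exp (- u)) \<le> Phi \<beta> x * exp (- (\<kappa> * u))"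
          using P0 \<kappa> u by (intro mult_mono) (auto simp: mult_left_le_one_le)
        moreover have "0 \<le> t * (norm x)\<^sup>2 * Phi \<beta> y" using P0 t by simp
        ultimately show ?thesis by linarith
      qed
      then show "Phi \<beta> y * exp (- (\<kappa> * t) * (norm y)\<^sup>2) - Phi \<beta> y * exp (- t * (norm y)\<^sup>2)
          \<le> t * (norm x)\<^sup>2 * Phi \<beta> y + Phi \<beta> x * exp (- (\<kappa> * t) * (norm y)\<^sup>2)"
        by (simp add: u_def right_diff_distrib mult.assoc)
    qed
    also have "\<dots> = t * (norm x)\<^sup>2 + Phi \<beta> x * (LINT y|lborel. exp (- (\<kappa> * t) * (norm (y::'a))\<^sup>2))"
    proof -
      have "(LINT y|lborel. t * (norm x)\<^sup>2 * Phi \<beta> y + Phi \<beta> x * exp (- (\<kappa> * t) * (norm (y::'a))\<^sup>2))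
        = (LINT y|lborel. t * (norm x)\<^sup>2 * Phi \<beta> (y::'a)) + (LINT y|lborel. Phi \<beta> x * exp (- (\<kappa> * t) * (norm (y::'a))\<^sup>2))"
        by (intro Bochner_Integration.integral_add integrable_mult_right Phi_integrable \<beta> gaussian_fourier \<kappa>t)
      then show ?thesis by (simp only: integral_mult_right_zero Phi_integral[OF \<beta>] mult_1_right)
    qed
    also have "(LINT y|lborel. exp (- (\<kappa> * t) * (norm (y::'a))\<^sup>2)) = (pi / (\<kappa> * t)) powr D"
    proof -
      have "complex_of_real (LINT y|lborel. exp (- (\<kappa> * t) * (norm (y::'a))\<^sup>2)) = fourier (\<lambda>y. exp (- (\<kappa> * t) * (norm (y::'a))\<^sup>2)) 0"
        by (simp add: fourier_def)
      then show ?thesis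
        unfolding gaussian_fourier(2)[OF \<kappa>t(1)] D_def by simp
    qed
    finally show ?thesis by (simp add: l_def)
  qed
  define q where "q = 1 / (1 - \<beta> / 2)"
  have q: "q > 0" using \<beta> by (simp add: q_def)
  define M where "M = \<beta> / 2 + D"
  have M: "M > 0" using \<beta> by (simp add: M_def D_def add_pos_nonneg)
  define C where "C = c / 2 * (\<kappa> / pi) powr D * (c / 2) powr (q * M)"
  have "C > 0" using c_pos \<kappa> by (simp add: C_def)
  moreover have "C * norm x powr (- (2 * q * M)) \<le> Phi \<beta> x" if x: "1 \<le> norm x" for x :: 'a
  proof -
    define r where "r = norm x"
    have r: "r \<ge> 1" using x by (simp add: r_def)
    \<comment> \<open>this \<open>t\<close> solves \<open>t r\<^sup>2 = (c/2) t\<^sup>\<beta>\<^sup>/\<^sup>2\<close>\<close>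
    define t where "t = (c / (2 * r\<^sup>2)) powr q"
    have b: "0 < c / (2 * r\<^sup>2)" using c_pos r by simp
    have "c / (2 * r\<^sup>2) \<le> 1"
    proof -
      have "c \<le> 2 * r\<^sup>2" using c_le power_mono[OF r, of 2] by simp
      then show ?thesis using r by (simp add: divide_le_eq)
    qed
    then have t: "0 < t" "t \<le> 1" using b q by (auto simp: t_def powr_le1)
    have h1: "t powr (1 - \<beta> / 2) = c / (2 * r\<^sup>2)"
      using \<beta> b c_pos unfolding t_def powr_powr q_def by simp
    have h2: "t = t powr (1 - \<beta> / 2) * t powr (\<beta> / 2)"
      using t by (simp flip: powr_add)
    have "t = c / (2 * r\<^sup>2) * t powr (\<beta> / 2)"
      using h2 unfolding h1 .
    from arg_cong[OF this, of "\<lambda>v. v * r\<^sup>2"] have tr: "t * r\<^sup>2 = c / 2 * t powr (\<beta> / 2)"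
      using r by simp
    from ineq[OF t, of x] have "c / 2 * t powr (\<beta> / 2) \<le> Phi \<beta> x * (pi / (\<kappa> * t)) powr D"
      unfolding r_def[symmetric] tr by simp
    then have "c / 2 * t powr (\<beta> / 2) * (\<kappa> * t / pi) powr D \<le> Phi \<beta> x * (pi / (\<kappa> * t)) powr D * (\<kappa> * t / pi) powr D"
      by (rule mult_right_mono) simp
    also have "\<dots> = Phi \<beta> x"
      using t \<kappa> by (simp add: mult.assoc flip: powr_mult)
    finally have "c / 2 * t powr (\<beta> / 2) * (\<kappa> * t / pi) powr D \<le> Phi \<beta> x" .
    also have "c / 2 * t powr (\<beta> / 2) * (\<kappa> * t / pi) powr D = C * r powr (- (2 * q * M))"
    proof -
      have 1: "(\<kappa> * t / pi) powr D = (\<kappa> / pi) powr D * t powr D"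
        using t \<kappa> by (simp flip: powr_mult)
      have 2: "t powr (\<beta> / 2) * t powr D = t powr M" by (simp add: M_def powr_add)
      have "t powr M = (c / 2 / r powr 2) powr (q * M)"
        using r by (simp add: t_def powr_powr)
      also have "\<dots> = (c / 2) powr (q * M) / (r powr 2) powr (q * M)"
        by (subst powr_divide) (use c_pos in auto)
      also have "\<dots> = (c / 2) powr (q * M) * r powr (- (2 * q * M))"
        by (simp only: powr_powr powr_minus divide_inverse mult.assoc)
      finally have 3: "t powr M = (c / 2) powr (q * M) * r powr (- (2 * q * M))" .
      show ?thesis unfolding 1 C_def using 2 3 by (simp add: mult_ac)
    qed
    finally show ?thesis by (simp add: r_def)
  qed
  moreover have "2 * q * M > 0" using q M by simp
  ultimately show ?thesis by blast
qed

lemma Phi_pos: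
  assumes \<beta>: "0 < \<beta>" "\<beta> < 2"
  shows "0 < Phi \<beta> (x::'a::euclidean_space)"
proof -
  obtain C N where C: "C > 0" "\<And>y::'a. 1 \<le> norm y \<Longrightarrow> C * norm y powr (- N) \<le> Phi \<beta> y"
    using Phi_polynomial_lower_bound[OF \<beta>, where 'a = 'a] by blast
  have "0 \<le> max 1 (norm x)" by simp
  then obtain y :: 'a where y: "norm y = max 1 (norm x)"
    using vector_choose_size by blast
  have "0 < C * norm y powr (- N)" using C y by simp
  also have "\<dots> \<le> Phi \<beta> y" by (rule C) (simp add: y)
  also have "\<dots> \<le> Phi \<beta> x" by (rule Phi_antimono[OF \<beta>]) (simp add: y)
  finally show ?thesis .
qed

lemma one_minus_cos_le: "1 - cos (x::real) \<le> x\<^sup>2"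
proof -
  have "1 - cos x = 2 * (sin (x / 2))\<^sup>2"
    using cos_double_sin[of "x / 2"] by simp
  also have "(sin (x / 2))\<^sup>2 \<le> (x / 2)\<^sup>2"
    using abs_sin_x_le_abs_x[of "x / 2"] by (simp only: abs_le_square_iff)
  finally show ?thesis by (simp add: power_divide) (smt (verit) zero_le_power2)
qed

text \<open>In the cosine representation of \<open>\<Phi>\<close> the second difference of \<open>cos\<langle>\<cdot>, \<xi>\<rangle>\<close> is at most a constant times
  \<open>\<bar>s\<bar>\<^sup>2 \<bar>\<xi>\<bar>\<^sup>2\<close>.\<close>

lemma Phi_second_difference:
  assumes \<beta>: "0 < \<beta>" "\<beta> < 2"
  shows "\<exists>C\<ge>0. \<forall>y s::'a::euclidean_space. \<bar>Phi \<beta> (y + s) + Phi \<beta> (y - s) - 2 * Phi \<beta> y\<bar> \<le> C * (norm s)\<^sup>2"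
proof -
  define G where "G \<xi> = exp (- (norm (\<xi>::'a) powr \<beta>))" for \<xi>
  have G: "integrable lborel G"
    unfolding G_def[abs_def] by (rule integrable_exp_neg_norm_powr) (use \<beta> in simp)
  have [measurable]: "G \<in> borel_measurable borel" using G by auto
  have G2: "integrable lborel (\<lambda>\<xi>. (norm \<xi>)\<^sup>2 * G \<xi>)"
    using integrable_norm_powr_mult_exp[of \<beta> 2, where 'a = 'a] \<beta> by (simp add: G_def)
  have Gc: "integrable lborel (\<lambda>\<xi>. G \<xi> * cos (x \<bullet> \<xi>))" for x
    by (rule Bochner_Integration.integrable_bound[OF G]) (auto simp: abs_mult mult_left_le)
  define c where "c = (2 * pi) ^ DIM('a)"
  have c: "c > 0" by (simp add: c_def)
  define I where "I = (LINT \<xi>|lborel. (norm \<xi>)\<^sup>2 * G \<xi>)"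
  have "\<bar>Phi \<beta> (y + s) + Phi \<beta> (y - s) - 2 * Phi \<beta> y\<bar> \<le> 2 * I / c * (norm s)\<^sup>2" for y s :: 'a
  proof -
    have val: "c * Phi \<beta> x = (LINT \<xi>|lborel. G \<xi> * cos (x \<bullet> \<xi>))" for x :: 'a
      unfolding c_def G_def by (rule Phi_eq_cos_integral[OF \<beta>])
    have "c * (Phi \<beta> (y + s) + Phi \<beta> (y - s) - 2 * Phi \<beta> y)
      = (LINT \<xi>|lborel. G \<xi> * cos ((y + s) \<bullet> \<xi>)) + (LINT \<xi>|lborel. G \<xi> * cos ((y - s) \<bullet> \<xi>)) - (LINT \<xi>|lborel. 2 * (G \<xi> * cos (y \<bullet> \<xi>)))"
      by (simp only: integral_mult_right_zero val[symmetric]) (simp add: algebra_simps)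
    also have "\<dots> = (LINT \<xi>|lborel. G \<xi> * cos ((y + s) \<bullet> \<xi>) + G \<xi> * cos ((y - s) \<bullet> \<xi>) - 2 * (G \<xi> * cos (y \<bullet> \<xi>)))"
      using Gc by simp
    also have "\<dots> = (LINT \<xi>|lborel. 2 * (G \<xi> * cos (y \<bullet> \<xi>) * (cos (s \<bullet> \<xi>) - 1)))"
      by (simp add: inner_add_left inner_diff_left cos_add cos_diff algebra_simps)
    finally have "\<bar>c * (Phi \<beta> (y + s) + Phi \<beta> (y - s) - 2 * Phi \<beta> y)\<bar>
        = \<bar>LINT \<xi>|lborel. 2 * (G \<xi> * cos (y \<bullet> \<xi>) * (cos (s \<bullet> \<xi>) - 1))\<bar>" by simp
    also have "\<dots> \<le> (LINT \<xi>|lborel. 2 * (norm s)\<^sup>2 * ((norm \<xi>)\<^sup>2 * G \<xi>))"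
    proof (rule integral_abs_bound[THEN order_trans], rule integral_mono)
      have bound: "\<bar>2 * (G \<xi> * cos (y \<bullet> \<xi>) * (cos (s \<bullet> \<xi>) - 1))\<bar> \<le> 2 * (norm s)\<^sup>2 * ((norm \<xi>)\<^sup>2 * G \<xi>)" for \<xi>
      proof -
        have "\<bar>cos (s \<bullet> \<xi>) - 1\<bar> \<le> (s \<bullet> \<xi>)\<^sup>2"
          using one_minus_cos_le[of "s \<bullet> \<xi>"] by simp
        also have "\<dots> \<le> (norm s * norm \<xi>)\<^sup>2"
          using Cauchy_Schwarz_ineq2[of s \<xi>] by (metis abs_ge_zero power2_abs power_mono)
        finally have "\<bar>cos (y \<bullet> \<xi>)\<bar> * \<bar>cos (s \<bullet> \<xi>) - 1\<bar> \<le> 1 * (norm s * norm \<xi>)\<^sup>2"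
          by (intro mult_mono) auto
        then have "2 * G \<xi> * (\<bar>cos (y \<bullet> \<xi>)\<bar> * \<bar>cos (s \<bullet> \<xi>) - 1\<bar>) \<le> 2 * G \<xi> * (1 * (norm s * norm \<xi>)\<^sup>2)"
          by (intro mult_left_mono) (auto simp: G_def)
        moreover have "2 * G \<xi> * (\<bar>cos (y \<bullet> \<xi>)\<bar> * \<bar>cos (s \<bullet> \<xi>) - 1\<bar>)
            = \<bar>2 * (G \<xi> * cos (y \<bullet> \<xi>) * (cos (s \<bullet> \<xi>) - 1))\<bar>"
          unfolding abs_mult by (simp add: G_def)
        moreover have "2 * G \<xi> * (1 * (norm s * norm \<xi>)\<^sup>2) = 2 * (norm s)\<^sup>2 * ((norm \<xi>)\<^sup>2 * G \<xi>)"
          by (simp add: power_mult_distrib)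
        ultimately show ?thesis by linarith
      qed
      show "\<bar>2 * (G \<xi> * cos (y \<bullet> \<xi>) * (cos (s \<bullet> \<xi>) - 1))\<bar> \<le> 2 * (norm s)\<^sup>2 * ((norm \<xi>)\<^sup>2 * G \<xi>)" for \<xi>
        by (rule bound)
      show int: "integrable lborel (\<lambda>\<xi>. 2 * (norm s)\<^sup>2 * ((norm \<xi>)\<^sup>2 * G \<xi>))"
        by (intro integrable_mult_right G2)
      show "integrable lborel (\<lambda>\<xi>. \<bar>2 * (G \<xi> * cos (y \<bullet> \<xi>) * (cos (s \<bullet> \<xi>) - 1))\<bar>)"
        by (rule Bochner_Integration.integrable_bound[OF int])
           (use order_trans[OF bound abs_ge_self] in \<open>auto intro!: AE_I2\<close>)
    qed
    also have "\<dots> = 2 * I * (norm s)\<^sup>2" by (simp add: I_def)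
    finally have "c * \<bar>Phi \<beta> (y + s) + Phi \<beta> (y - s) - 2 * Phi \<beta> y\<bar> \<le> 2 * I * (norm s)\<^sup>2"
      using c by (simp only: abs_mult[of c] abs_of_pos)
    then show ?thesis
      using c by (simp only: times_divide_eq_left pos_le_divide_eq mult.commute[of c])
  qed
  moreover have "0 \<le> 2 * I / c"
    using c unfolding I_def G_def by (intro divide_nonneg_pos mult_nonneg_nonneg integral_nonneg) auto
  ultimately show ?thesis by blast
qed

section \<open>Comparison with the centre\<close>

text \<open>The point \<open>w\<close> satisfies \<open>\<bar>w\<bar>\<^sup>2 = \<bar>y\<bar>\<^sup>2 + \<bar>s\<bar>\<^sup>2\<close>. Spreading \<open>(y, s)\<close> to \<open>(0, w)\<close> and then \<open>(w, w)\<close> to \<open>(y + s, y - s)\<close>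
  gives the inequality; the second spread is admissible by the parallelogram law.\<close>

lemma Phi_square_mult_le:
  fixes y s :: "'a::euclidean_space"
  assumes \<beta>: "0 < \<beta>" "\<beta> < 2"
  shows "(Phi \<beta> y)\<^sup>2 * (Phi \<beta> s)\<^sup>2 \<le> (Phi \<beta> (0::'a))\<^sup>2 * (Phi \<beta> (y + s) * Phi \<beta> (y - s))"
proof -
  note nn = Phi_nonneg[OF \<beta>, where 'a = 'a]
  have "0 \<le> sqrt ((norm y)\<^sup>2 + (norm s)\<^sup>2)" by simp
  then obtain w :: 'a where "norm w = sqrt ((norm y)\<^sup>2 + (norm s)\<^sup>2)"
    using vector_choose_size by blast
  then have w: "(norm w)\<^sup>2 = (norm y)\<^sup>2 + (norm s)\<^sup>2" by simp
  have "Phi \<beta> y * Phi \<beta> s \<le> Phi \<beta> (0::'a) * Phi \<beta> w"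
    by (rule Phi_spread[OF \<beta>]) (auto simp: w)
  then have "(Phi \<beta> y * Phi \<beta> s)\<^sup>2 \<le> (Phi \<beta> (0::'a) * Phi \<beta> w)\<^sup>2"
    using nn by (intro power_mono) auto
  moreover have "Phi \<beta> w * Phi \<beta> w \<le> Phi \<beta> (y + s) * Phi \<beta> (y - s)"
  proof -
    have par: "(norm (y + s))\<^sup>2 + (norm (y - s))\<^sup>2 = (norm w)\<^sup>2 + (norm w)\<^sup>2"
      unfolding w by (simp add: power2_norm_eq_inner inner_add inner_diff algebra_simps inner_commute)
    show ?thesis
    proof (cases "norm (y + s) \<le> norm (y - s)")
      case True
      then have "(norm (y + s))\<^sup>2 \<le> (norm (y - s))\<^sup>2" by (intro power_mono) auto
      then have "(norm (y + s))\<^sup>2 \<le> (norm w)\<^sup>2" using par by linarith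
      then have "norm (y + s) \<le> norm w" by (rule power2_le_imp_le) simp
      then show ?thesis using par by (intro Phi_spread[OF \<beta>]) auto
    next
      case False
      then have "(norm (y - s))\<^sup>2 \<le> (norm (y + s))\<^sup>2" by (intro power_mono) auto
      then have "(norm (y - s))\<^sup>2 \<le> (norm w)\<^sup>2" using par by linarith
      then have "norm (y - s) \<le> norm w" by (rule power2_le_imp_le) simp
      then have "Phi \<beta> w * Phi \<beta> w \<le> Phi \<beta> (y - s) * Phi \<beta> (y + s)"
        using par by (intro Phi_spread[OF \<beta>]) auto
      then show ?thesis by (simp add: mult.commute)
    qed
  qed
  then have "(Phi \<beta> (0::'a))\<^sup>2 * (Phi \<beta> w * Phi \<beta> w) \<le> (Phi \<beta> (0::'a))\<^sup>2 * (Phi \<beta> (y + s) * Phi \<beta> (y - s))"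
    by (rule mult_left_mono) simp
  ultimately show ?thesis
    unfolding power_mult_distrib power2_eq_square[of "Phi \<beta> w"] by (rule order_trans)
qed

lemma Phi_norm_cong:
  fixes x y :: "'a::euclidean_space"
  assumes "0 < \<beta>" "\<beta> < 2" "norm x = norm y"
  shows "Phi \<beta> x = Phi \<beta> y"
  by (rule antisym; rule Phi_antimono[OF assms(1,2)]; simp add: assms(3))

text \<open>The logarithmic factor of the integrand, which is the negative of the second difference of \<open>log \<Phi>\<close>.\<close>

definition log_defect :: "real \<Rightarrow> 'a::euclidean_space \<Rightarrow> 'a \<Rightarrow> real" where
  "log_defect \<beta> y s = ln ((Phi \<beta> y)\<^sup>2 / (Phi \<beta> (y + s) * Phi \<beta> (y - s)))"

lemma log_defect_at_0:
  assumes "0 < \<beta>" "\<beta> < 2"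
  shows "log_defect \<beta> (0::'a) (s::'a::euclidean_space) = 2 * ln (Phi \<beta> (0::'a) / Phi \<beta> s)"
proof -
  have "Phi \<beta> (- s) = Phi \<beta> s" by (rule Phi_norm_cong[OF assms]) simp
  then show ?thesis
    using Phi_pos[OF assms, of "0::'a"] Phi_pos[OF assms, of s]
    by (simp add: log_defect_def ln_div ln_mult ln_realpow)
qed

lemma log_defect_le_at_0:
  assumes \<beta>: "0 < \<beta>" "\<beta> < 2"
  shows "log_defect \<beta> y s \<le> log_defect \<beta> 0 (s::'a::euclidean_space)"
proof -
  note pos = Phi_pos[OF \<beta>, where 'a = 'a]
  have "Phi \<beta> (0 - s) = Phi \<beta> (0 + s)" by (rule Phi_norm_cong[OF \<beta>]) simp
  then have "(Phi \<beta> y)\<^sup>2 / (Phi \<beta> (y + s) * Phi \<beta> (y - s)) \<le> (Phi \<beta> (0::'a))\<^sup>2 / (Phi \<beta> (0 + s) * Phi \<beta> (0 - s))"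
    using Phi_square_mult_le[OF \<beta>, of y s] pos[of "y + s"] pos[of "y - s"] pos[of s]
    by (simp add: frac_le_eq divide_simps power2_eq_square[of "Phi \<beta> s"] mult_ac)
  then show ?thesis
    unfolding log_defect_def using pos by (subst ln_le_cancel_iff) (auto intro!: divide_pos_pos mult_pos_pos zero_less_power)
qed

text \<open>Above, the defect is controlled by its value at \<open>y = 0\<close>: quadratically near \<open>s = 0\<close>, where \<open>\<Phi>(0) - \<Phi>(s)\<close> is, up to sign,
  half a second difference, and logarithmically for large \<open>s\<close> by the polynomial lower bound. Below, for small \<open>s\<close>, the
  geometric mean of \<open>\<Phi>(y \<plusminus> s)\<close> is at most their arithmetic mean, which differs from \<open>\<Phi>(y)\<close> by
  half a second difference; for large \<open>s\<close> it suffices that \<open>\<Phi> \<le> \<Phi>(0)\<close>.\<close>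

lemma log_defect_bound:
  assumes \<beta>: "0 < \<beta>" "\<beta> < 2"
  shows "\<exists>K\<ge>0. \<forall>s::'a::euclidean_space.
    (norm s \<le> 1 \<longrightarrow> \<bar>log_defect \<beta> y s\<bar> \<le> K * (norm s)\<^sup>2) \<and>
    (1 \<le> norm s \<longrightarrow> \<bar>log_defect \<beta> y s\<bar> \<le> K * norm s powr (\<beta> / 2))"
proof -
  note pos = Phi_pos[OF \<beta>, where 'a = 'a]
  note nn = Phi_nonneg[OF \<beta>, where 'a = 'a]
  have le0: "Phi \<beta> x \<le> Phi \<beta> (0::'a)" for x :: 'a by (rule Phi_antimono[OF \<beta>]) simp
  obtain C where C: "C \<ge> 0"
    "\<And>y s::'a. \<bar>Phi \<beta> (y + s) + Phi \<beta> (y - s) - 2 * Phi \<beta> y\<bar> \<le> C * (norm s)\<^sup>2"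
    using Phi_second_difference[OF \<beta>, where 'a = 'a] by blast
  obtain c N where c: "c > 0" "N > 0" "\<And>x::'a. 1 \<le> norm x \<Longrightarrow> c * norm x powr (- N) \<le> Phi \<beta> x"
    using Phi_polynomial_lower_bound[OF \<beta>, where 'a = 'a] by blast
  have low: "- (C / Phi \<beta> y * (norm s)\<^sup>2) \<le> log_defect \<beta> y s" for s
  proof -
    define A where "A = (Phi \<beta> (y + s) + Phi \<beta> (y - s)) / 2"
    have A: "A > 0" using pos[of "y + s"] pos[of "y - s"] by (simp add: A_def)
    have "0 \<le> (Phi \<beta> (y + s) - Phi \<beta> (y - s))\<^sup>2" by simp
    then have AGM: "Phi \<beta> (y + s) * Phi \<beta> (y - s) \<le> A\<^sup>2"
      unfolding A_def by (simp add: power2_eq_square field_simps)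
    have "A - Phi \<beta> y \<le> C / 2 * (norm s)\<^sup>2"
      using C(2)[of y s] unfolding A_def by (simp add: abs_le_iff field_simps)
    then have "(A - Phi \<beta> y) / Phi \<beta> y \<le> C / 2 * (norm s)\<^sup>2 / Phi \<beta> y"
      using pos[of y] by (intro divide_right_mono) auto
    moreover have "ln (A / Phi \<beta> y) \<le> A / Phi \<beta> y - 1"
      using A pos[of y] by (intro ln_le_minus_one) auto
    moreover have "A / Phi \<beta> y - 1 = (A - Phi \<beta> y) / Phi \<beta> y" using pos[of y] by (simp add: diff_divide_distrib)
    ultimately have "ln (A / Phi \<beta> y) \<le> C / 2 * (norm s)\<^sup>2 / Phi \<beta> y" by linarith
    moreover have "log_defect \<beta> y s \<ge> - (2 * ln (A / Phi \<beta> y))"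
    proof -
      have "(Phi \<beta> y)\<^sup>2 / A\<^sup>2 \<le> (Phi \<beta> y)\<^sup>2 / (Phi \<beta> (y + s) * Phi \<beta> (y - s))"
        using AGM A pos by (intro divide_left_mono) auto
      then have "ln ((Phi \<beta> y)\<^sup>2 / A\<^sup>2) \<le> log_defect \<beta> y s"
        unfolding log_defect_def using A pos
        by (subst ln_le_cancel_iff) (auto intro!: divide_pos_pos mult_pos_pos zero_less_power)
      moreover have "ln ((Phi \<beta> y)\<^sup>2 / A\<^sup>2) = - (2 * ln (A / Phi \<beta> y))"
        using A pos[of y] by (simp add: ln_div ln_realpow)
      ultimately show ?thesis by simp
    qed
    ultimately show ?thesis by (simp add: field_simps)
  qed
  have low': "- (2 * ln (Phi \<beta> (0::'a) / Phi \<beta> y)) \<le> log_defect \<beta> y s" for s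
  proof -
    have "(Phi \<beta> y)\<^sup>2 / (Phi \<beta> (0::'a))\<^sup>2 \<le> (Phi \<beta> y)\<^sup>2 / (Phi \<beta> (y + s) * Phi \<beta> (y - s))"
      using le0 pos nn unfolding power2_eq_square[of "Phi \<beta> 0"]
      by (intro divide_left_mono mult_mono) auto
    then have "ln ((Phi \<beta> y)\<^sup>2 / (Phi \<beta> (0::'a))\<^sup>2) \<le> log_defect \<beta> y s"
      unfolding log_defect_def using pos
      by (subst ln_le_cancel_iff) (auto intro!: divide_pos_pos mult_pos_pos zero_less_power)
    moreover have "ln ((Phi \<beta> y)\<^sup>2 / (Phi \<beta> (0::'a))\<^sup>2) = - (2 * ln (Phi \<beta> (0::'a) / Phi \<beta> y))"
      using pos[of y] pos[of 0] by (simp add: ln_div ln_realpow)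
    ultimately show ?thesis by simp
  qed
  obtain e1 :: 'a where e1: "norm e1 = 1"
    using vector_choose_size[of 1] by (metis zero_le_one)
  have up_near: "log_defect \<beta> y s \<le> C / Phi \<beta> e1 * (norm s)\<^sup>2" if "norm s \<le> 1" for s
  proof -
    have "Phi \<beta> (0 - s) = Phi \<beta> (0 + s)" by (rule Phi_norm_cong[OF \<beta>]) simp
    then have "2 * (Phi \<beta> (0::'a) - Phi \<beta> s) \<le> C * (norm s)\<^sup>2"
      using C(2)[of 0 s] by (simp add: abs_le_iff)
    moreover have "Phi \<beta> e1 \<le> Phi \<beta> s" by (rule Phi_antimono[OF \<beta>]) (simp add: e1 that)
    ultimately have "2 * (Phi \<beta> (0::'a) - Phi \<beta> s) / Phi \<beta> s \<le> C * (norm s)\<^sup>2 / Phi \<beta> e1"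
      using C(1) pos[of e1] by (intro frac_le) auto
    then have "2 * ((Phi \<beta> (0::'a) - Phi \<beta> s) / Phi \<beta> s) \<le> C / Phi \<beta> e1 * (norm s)\<^sup>2"
      by (simp only: times_divide_eq_right times_divide_eq_left)
    moreover have "ln (Phi \<beta> (0::'a) / Phi \<beta> s) \<le> Phi \<beta> (0::'a) / Phi \<beta> s - 1"
      using pos by (intro ln_le_minus_one) auto
    moreover have "Phi \<beta> (0::'a) / Phi \<beta> s - 1 = (Phi \<beta> (0::'a) - Phi \<beta> s) / Phi \<beta> s"
      using pos[of s] by (simp add: diff_divide_distrib)
    ultimately have "2 * ln (Phi \<beta> (0::'a) / Phi \<beta> s) \<le> C / Phi \<beta> e1 * (norm s)\<^sup>2"
      by linarith
    with log_defect_le_at_0[OF \<beta>, of y s] show ?thesis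
      unfolding log_defect_at_0[OF \<beta>] by linarith
  qed
  define L where "L = \<bar>ln (Phi \<beta> (0::'a) / c)\<bar> + 2 * N / \<beta>"
  have up_far: "log_defect \<beta> y s \<le> 2 * L * norm s powr (\<beta> / 2)" if s: "1 \<le> norm s" for s
  proof -
    have r: "1 \<le> norm s powr (\<beta> / 2)" using s \<beta> by (simp add: ge_one_powr_ge_zero)
    have s0: "s \<noteq> 0" using s by auto
    then have cN: "0 < c * norm s powr (- N)" using c(1) by simp
    then have "Phi \<beta> (0::'a) / Phi \<beta> s \<le> Phi \<beta> (0::'a) / (c * norm s powr (- N))"
      using c(1) c(3)[OF s] pos[of 0] pos[of s] by (intro divide_left_mono mult_pos_pos) auto
    then have "ln (Phi \<beta> (0::'a) / Phi \<beta> s) \<le> ln (Phi \<beta> (0::'a) / (c * norm s powr (- N)))"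
      using pos[of 0] pos[of s] cN by (subst ln_le_cancel_iff) (auto intro!: divide_pos_pos)
    also have "\<dots> = ln (Phi \<beta> (0::'a) / c) + N * ln (norm s)"
      using pos[of 0] c s s0 by (simp add: ln_div ln_mult ln_powr)
    also have "\<dots> \<le> \<bar>ln (Phi \<beta> (0::'a) / c)\<bar> * norm s powr (\<beta> / 2) + N * (norm s powr (\<beta> / 2) / (\<beta> / 2))"
    proof (intro add_mono mult_left_mono)
      show "ln (Phi \<beta> (0::'a) / c) \<le> \<bar>ln (Phi \<beta> (0::'a) / c)\<bar> * norm s powr (\<beta> / 2)"
        using mult_left_mono[OF r, of "\<bar>ln (Phi \<beta> (0::'a) / c)\<bar>"] by simp
      show "ln (norm s) \<le> norm s powr (\<beta> / 2) / (\<beta> / 2)"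
        using s \<beta> by (intro ln_powr_bound) auto
    qed (use c in simp)
    also have "\<dots> = L * norm s powr (\<beta> / 2)"
      using \<beta> by (simp add: L_def field_simps)
    finally show ?thesis
      using log_defect_le_at_0[OF \<beta>, of y s] unfolding log_defect_at_0[OF \<beta>] by linarith
  qed
  define l0 where "l0 = ln (Phi \<beta> (0::'a) / Phi \<beta> y)"
  have l0: "l0 \<ge> 0" unfolding l0_def using le0[of y] pos[of y] by (intro ln_ge_zero) simp
  define K where "K = C / Phi \<beta> y + C / Phi \<beta> e1 + 2 * L + 2 * l0"
  have parts: "0 \<le> C / Phi \<beta> y" "0 \<le> C / Phi \<beta> e1" "0 \<le> 2 * L" "0 \<le> 2 * l0"
    using C(1) nn l0 c \<beta> by (auto simp: L_def intro!: add_nonneg_nonneg)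
  have "\<bar>log_defect \<beta> y s\<bar> \<le> K * (norm s)\<^sup>2" if "norm s \<le> 1" for s
  proof -
    have "C / Phi \<beta> y * (norm s)\<^sup>2 \<le> K * (norm s)\<^sup>2" "C / Phi \<beta> e1 * (norm s)\<^sup>2 \<le> K * (norm s)\<^sup>2"
      using parts by (intro mult_right_mono; simp add: K_def)+
    then show ?thesis using low[of s] up_near[OF that] by linarith
  qed
  moreover have "\<bar>log_defect \<beta> y s\<bar> \<le> K * norm s powr (\<beta> / 2)" if s: "1 \<le> norm s" for s
  proof -
    have r: "1 \<le> norm s powr (\<beta> / 2)" using s \<beta> by (simp add: ge_one_powr_ge_zero)
    have "2 * L * norm s powr (\<beta> / 2) \<le> K * norm s powr (\<beta> / 2)"
      using parts by (intro mult_right_mono) (simp_all add: K_def)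
    moreover have "2 * l0 * 1 \<le> K * norm s powr (\<beta> / 2)"
      using parts r by (intro mult_mono) (simp_all add: K_def)
    ultimately show ?thesis using low'[of s] up_far[OF s] unfolding l0_def by linarith
  qed
  moreover have "K \<ge> 0" using parts by (simp add: K_def)
  ultimately show ?thesis by blast
qed

lemma LY_integrand_eq: "LY_integrand \<beta> y s = log_defect \<beta> y s / norm s powr (real DIM('a) + \<beta>)"
  for y s :: "'a::euclidean_space"
  by (simp add: LY_integrand_def log_defect_def)

text \<open>The exponents work out because \<open>d + \<beta> - 2 < d < d + \<beta>/2\<close>.\<close>

lemma integrable_LY_integrand:
  assumes \<beta>: "0 < \<beta>" "\<beta> < 2"
  shows "integrable lborel (LY_integrand \<beta> (y::'a::euclidean_space))"
proof -
  obtain K where K: "K \<ge> 0"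
    "\<And>s::'a. norm s \<le> 1 \<Longrightarrow> \<bar>log_defect \<beta> y s\<bar> \<le> K * (norm s)\<^sup>2"
    "\<And>s::'a. 1 \<le> norm s \<Longrightarrow> \<bar>log_defect \<beta> y s\<bar> \<le> K * norm s powr (\<beta> / 2)"
    using log_defect_bound[OF \<beta>, of y] by blast
  define d where "d = real DIM('a)"
  let ?near = "\<lambda>s::'a. indicator {s. norm s \<le> 1} s * norm s powr (- (d + \<beta> - 2))"
  let ?far = "\<lambda>s::'a. indicator {s. 1 \<le> norm s} s * norm s powr (- (d + \<beta> / 2))"
  have int: "integrable lborel (\<lambda>s. K * ?near s + K * ?far s)"
    by (intro Bochner_Integration.integrable_add integrable_mult_right
        integrable_norm_powr_near integrable_norm_powr_far) (use \<beta> in \<open>auto simp: d_def\<close>)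
  have [measurable]: "Phi \<beta> \<in> borel_measurable (borel :: 'a measure)"
    by (intro borel_measurable_continuous_onI Phi_continuous \<beta>)
  show ?thesis
  proof (rule Bochner_Integration.integrable_bound[OF int])
    show "LY_integrand \<beta> y \<in> borel_measurable lborel"
      unfolding LY_integrand_def[abs_def] by measurable
    show "AE s in lborel. norm (LY_integrand \<beta> y s) \<le> norm (K * ?near s + K * ?far s)"
      using AE_lborel_singleton[of 0]
    proof eventually_elim
      case (elim s)
      then have n: "norm s > 0" by simp
      have eq: "norm (LY_integrand \<beta> y s) = \<bar>log_defect \<beta> y s\<bar> * norm s powr (- (d + \<beta>))"
        by (simp add: LY_integrand_eq d_def powr_minus divide_inverse abs_mult del: minus_add_distrib)
      have nn: "0 \<le> K * ?near s" "0 \<le> K * ?far s"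
        using K(1) by (auto intro!: mult_nonneg_nonneg)
      show ?case
      proof (cases "norm s \<le> 1")
        case True
        have "\<bar>log_defect \<beta> y s\<bar> * norm s powr (- (d + \<beta>)) \<le> K * (norm s)\<^sup>2 * norm s powr (- (d + \<beta>))"
          by (intro mult_right_mono K True) simp
        also have "\<dots> = K * (norm s powr 2 * norm s powr (- (d + \<beta>)))"
          using n by simp
        also have "\<dots> = K * ?near s"
        proof -
          have "2 + - (d + \<beta>) = - (d + \<beta> - 2)" by simp
          moreover have "indicator {s. norm s \<le> 1} s = (1 :: real)" using True by simp
          ultimately show ?thesis by (simp only: powr_add[symmetric] mult_1_left)
        qed
        finally show ?thesis using nn unfolding eq by simp
      next
        case False
        then have s: "1 \<le> norm s" by simp
        have "\<bar>log_defect \<beta> y s\<bar> * norm s powr (- (d + \<beta>)) \<le> K * norm s powr (\<beta> / 2) * norm s powr (- (d + \<beta>))"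
          by (intro mult_right_mono K s) simp
        also have "\<dots> = K * (norm s powr (\<beta> / 2) * norm s powr (- (d + \<beta>)))" by simp
        also have "\<dots> = K * norm s powr (- (d + \<beta> / 2))"
        proof -
          have "\<beta> / 2 + - (d + \<beta>) = - (d + \<beta> / 2)" by simp
          then show ?thesis by (simp only: powr_add[symmetric])
        qed
        also have "\<dots> = K * ?far s" using s by simp
        finally show ?thesis using nn unfolding eq by simp
      qed
    qed
  qed
qed

lemma LY_integral_le_at_0:
  assumes \<beta>: "0 < \<beta>" "\<beta> < 2"
  shows "(LINT s|lborel. LY_integrand \<beta> (y::'a::euclidean_space) s) \<le> (LINT s|lborel. LY_integrand \<beta> (0::'a) s)"
proof (rule integral_mono)
  show "LY_integrand \<beta> y s \<le> LY_integrand \<beta> 0 s" for s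
    unfolding LY_integrand_eq by (intro divide_right_mono log_defect_le_at_0 \<beta>) simp
qed (rule integrable_LY_integrand[OF \<beta>])+

theorem proposition2p2:
  fixes \<beta> :: real and e :: "real ^ 'd"
  assumes "0 < \<beta>" and "\<beta> < 2" and "norm e = 1"
  shows "(\<forall>y::real^'d. integrable lborel (LY_integrand \<beta> y))
    \<and> integrable lborel (frac_laplacian_integrand \<beta> (\<lambda>x::real^'d. ln (Phi \<beta> x)) 0)
    \<and> integrable lborel
        (\<lambda>h::real^'d. psi \<beta> e ((norm h)\<^sup>2) / norm h powr (real CARD('d) + \<beta>))
    \<and> C_LY \<beta> TYPE(real^'d)
        = ereal (frac_laplacian \<beta> (\<lambda>x::real^'d. ln (Phi \<beta> x)) 0)
    \<and> frac_laplacian \<beta> (\<lambda>x::real^'d. ln (Phi \<beta> x)) 0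
        = frac_const \<beta> CARD('d) *
          (LINT h::real^'d|lborel.
             psi \<beta> e ((norm h)\<^sup>2) / norm h powr (real CARD('d) + \<beta>))"
proof -
  note \<beta> = assms(1,2)
  have int: "integrable lborel (LY_integrand \<beta> y)" for y :: "real^'d"
    by (rule integrable_LY_integrand[OF \<beta>])
  have lap: "frac_laplacian_integrand \<beta> (\<lambda>x::real^'d. ln (Phi \<beta> x)) 0 = LY_integrand \<beta> 0"
  proof
    fix h :: "real^'d"
    have "Phi \<beta> (- h) = Phi \<beta> h" by (rule Phi_norm_cong[OF \<beta>]) simp
    then show "frac_laplacian_integrand \<beta> (\<lambda>x. ln (Phi \<beta> x)) 0 h = LY_integrand \<beta> 0 h"
      using Phi_pos[OF \<beta>, of "0::real^'d"] Phi_pos[OF \<beta>, of h]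
      by (simp add: LY_integrand_eq log_defect_at_0[OF \<beta>] frac_laplacian_integrand_def ln_div)
  qed
  have psi: "psi \<beta> e ((norm h)\<^sup>2) / norm h powr (real CARD('d) + \<beta>) = LY_integrand \<beta> 0 h / 2" for h :: "real^'d"
  proof -
    have "Phi \<beta> (norm h *\<^sub>R e) = Phi \<beta> h"
      by (rule Phi_norm_cong[OF \<beta>]) (simp add: assms)
    then show ?thesis
      by (simp add: psi_def F_prof_def LY_integrand_eq log_defect_at_0[OF \<beta>])
  qed
  have sup: "(SUP y::real^'d. ereal (LINT s|lborel. LY_integrand \<beta> y s)) = ereal (LINT s|lborel. LY_integrand \<beta> (0::real^'d) s)"
    by (rule antisym) (auto intro!: SUP_least SUP_upper LY_integral_le_at_0 \<beta>)
  show ?thesis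
    unfolding psi lap C_LY_def sup frac_laplacian_def
    using int by simp
qed

end
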